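(* Let $\nu_1,\nu_2,\dots$ be log-concave probability measures on $\mathbb{Z}_+$ and let $X_1,X_2,\dots$ be independent random variables with $X_i$ distributed according to $\nu_i$. Let $n\ge1$ be an integer and let $R$ be a real number satisfying $0<R<R_n^{\max}:=\sup_{\lambda<\lambda^{\max}}E(S^\lambda_n)$. Then, for $0<\lambda<\lambda'<\lambda^{\max}$, $$P(\mathsf{X}^\lambda\in\cdot\mid S^\lambda_n>R)\prec P(\mathsf{X}^{\lambda'}\in\cdot\mid S^{\lambda'}_n>R),$$ $$P(\mathsf{X}^\lambda\in\cdot\mid S^\lambda_n<R)\prec P(\mathsf{X}^{\lambda'}\in\cdot\mid S^{\lambda'}_n<R),$$ $$P(\mathsf{X}^\lambda\in\cdot\mid S^\lambda_n<R)\prec P(\mathsf{X}^{\lambda'}\in\cdot\mid S^{\lambda'}_n>R).$$ Furthermore, for $0<\lambda<\lambda^{\max}$ and $k\in\mathbb{N}$ satisfying $P(S_n=k)>0$, where $S_n=X_1+\dots+X_n$, $$P(\mathsf{X}^\lambda\in\cdot\mid S^\lambda_n\le k)\prec P(\mathsf{X}^\lambda\in\cdot\mid S^\lambda_n=k)\prec P(\mathsf{X}^\lambda\in\cdot\mid S^\lambda_n\ge k).$$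
   Context: $\mathbb{Z}_+=\{0,1,2,\dots\}$. For $\lambda>0$, let $Z^\lambda_i:=\sum_{z}\lambda^z\nu_i(z)$ and $\lambda^{\max}:=\sup\{\lambda>0: Z^\lambda_i<\infty\text{ for all }i\}\in(0,\infty]$. For $\lambda\in(0,\lambda^{\max})$ the tilted measures are $\nu^\lambda_i(x):=\lambda^x\nu_i(x)/Z^\lambda_i$, and $\mathsf{X}^\lambda=(X^\lambda_1,X^\lambda_2,\dots)$ is a sequence of independent random variables with $X_i^\lambda$ distributed according to $\nu_i^\lambda$; $S^\lambda_n:=X^\lambda_1+\dots+X^\lambda_n$. Let $\max_i:=\sup\{x\in\mathbb{Z}_+:\nu_i(x)>0\}$ (possibly infinite). The measure $\nu_i$ is log-concave if $\nu_i(x)>0$ for all integers $x$ with $0\le x\le\max_i$ and $\frac{\nu_i(x-1)}{\nu_i(x)}\le\frac{\nu_i(x)}{\nu_i(x+1)}$ for all integers $0<x<\max_i$. Stochastic order: sequences are ordered coordinatewise, $\mathsf{x}\le\mathsf{x}'$ iff $x_i\le x_i'$ for all $i$. For probability measures $\mu,\mu'$ on sequences in $\mathbb{Z}_+$, $\mu\prec\mu'$ means that there is a probability measure on the product space (a coupling) with marginals $\mu$ and $\mu'$ such that a pair $(\mathsf{X},\mathsf{X}')$ with this law satisfies $\mathsf{X}\le\mathsf{X}'$ almost surely. *)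

theory Defs
  imports "HOL-Probability.Probability"
begin

definition max_supp :: "nat pmf \<Rightarrow> enat" where
  "max_supp p = Sup {enat x | x. pmf p x > 0}"

definition log_concave :: "nat pmf \<Rightarrow> bool" where
  "log_concave p \<longleftrightarrow>
     (\<forall>x. enat x \<le> max_supp p \<longrightarrow> pmf p x > 0) \<and>
     (\<forall>x. 0 < x \<and> enat x < max_supp p \<longrightarrow>
        pmf p (x - 1) / pmf p x \<le> pmf p x / pmf p (x + 1))"

definition partition_fun :: "real \<Rightarrow> nat pmf \<Rightarrow> ennreal" where
  "partition_fun l p = (\<Sum>z. ennreal (l ^ z * pmf p z))"

definition lambda_max :: "(nat \<Rightarrow> nat pmf) \<Rightarrow> ereal" where
  "lambda_max \<nu> = Sup {ereal l | l. 0 < l \<and> (\<forall>i. partition_fun l (\<nu> i) < \<infinity>)}"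

text \<open>
  The argument of \<^const>\<open>embed_pmf\<close> is a probability mass function only for
  \<open>l > 0\<close> with finite partition function, see \<open>pmf_tilt\<close> below; every
  \<open>l\<close> strictly between 0 and \<open>lambda_max\<close> is of this kind.
\<close>

definition tilt :: "real \<Rightarrow> nat pmf \<Rightarrow> nat pmf" where
  "tilt l p = embed_pmf (\<lambda>x. l ^ x * pmf p x / enn2real (partition_fun l p))"

lemma pmf_tilt:
  assumes "l > 0" and "partition_fun l p < \<infinity>"
  shows "pmf (tilt l p) x = l ^ x * pmf p x / enn2real (partition_fun l p)"
proof -
  let ?Z = "enn2real (partition_fun l p)"
  have nonneg: "0 \<le> l ^ z * pmf p z" for z
    using assms(1) by simp
  have "partition_fun l p \<noteq> 0"
  proof
    assume "partition_fun l p = 0"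
    then have "ennreal (l ^ z * pmf p z) = 0" for z
      unfolding partition_fun_def by (subst (asm) suminf_eq_zero_iff) auto
    then have "pmf p z = 0" for z
      using assms(1) nonneg[of z] by (metis ennreal_eq_0_iff mult_eq_0_iff order_antisym
          power_not_zero less_irrefl)
    then show False
      using set_pmf_not_empty[of p] by (auto simp: set_pmf_eq)
  qed
  then have Z: "?Z > 0" "ennreal ?Z = partition_fun l p"
    using assms(2) by (auto simp: enn2real_positive_iff zero_less_iff_neq_zero)
  have "(\<integral>\<^sup>+ z. ennreal (l ^ z * pmf p z / ?Z) \<partial>count_space UNIV)
      = (\<Sum>z. ennreal (l ^ z * pmf p z) / ennreal ?Z)"
    using Z(1) nonneg by (simp add: nn_integral_count_space_nat divide_ennreal)
  also have "\<dots> = 1"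
    using Z \<open>partition_fun l p \<noteq> 0\<close> assms(2)
    by (simp add: ennreal_suminf_divide partition_fun_def[symmetric] ennreal_divide_self)
  finally show ?thesis
    unfolding tilt_def using Z(1) nonneg by (intro pmf_embed_pmf) auto
qed

text \<open>
  Sequences are indexed from 0: the entry at \<open>i\<close> is the one usually numbered
  \<open>i + 1\<close>, so the first \<open>n\<close> entries are those with index \<open>i < n\<close>.
\<close>

abbreviation seq_space :: "(nat \<Rightarrow> nat) measure" where
  "seq_space \<equiv> PiM UNIV (\<lambda>_. count_space UNIV)"

definition indep_with_laws ::
    "'a measure \<Rightarrow> (nat \<Rightarrow> 'a \<Rightarrow> nat) \<Rightarrow> (nat \<Rightarrow> nat pmf) \<Rightarrow> bool" where
  "indep_with_laws M X \<mu> \<longleftrightarrow>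
     prob_space M \<and>
     prob_space.indep_vars M (\<lambda>_. count_space UNIV) X UNIV \<and>
     (\<forall>i. distr M (count_space UNIV) (X i) = measure_pmf (\<mu> i))"

definition partial_sum :: "(nat \<Rightarrow> 'a \<Rightarrow> nat) \<Rightarrow> nat \<Rightarrow> 'a \<Rightarrow> nat" where
  "partial_sum X n \<omega> = (\<Sum>i<n. X i \<omega>)"

text \<open>The conditional law of the sequence \<open>X\<close> given \<open>Q\<close>, where \<open>Q\<close> has positive probability.\<close>

definition cond_law ::
    "'a measure \<Rightarrow> (nat \<Rightarrow> 'a \<Rightarrow> nat) \<Rightarrow> ('a \<Rightarrow> bool) \<Rightarrow> (nat \<Rightarrow> nat) measure" where
  "cond_law M X Q =
     distr (uniform_measure M {\<omega> \<in> space M. Q \<omega>}) seq_space (\<lambda>\<omega> i. X i \<omega>)"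

definition stoch_le ::
    "(nat \<Rightarrow> nat) measure \<Rightarrow> (nat \<Rightarrow> nat) measure \<Rightarrow> bool" (infix "\<prec>\<^sub>s\<^sub>t" 50) where
  "\<mu> \<prec>\<^sub>s\<^sub>t \<mu>' \<longleftrightarrow>
     (\<exists>P. prob_space P \<and> sets P = sets (seq_space \<Otimes>\<^sub>M seq_space) \<and>
        distr P seq_space fst = \<mu> \<and> distr P seq_space snd = \<mu>' \<and>
        (AE z in P. fst z \<le> snd z))"

end

theory Submission imports Defs begin

text \<open>
  The idea is to separate the influence of the sum $S_n$ from that of the sequence given $S_n$.
  Tilting by $\lambda$ and conditioning on an event $\{S_n \<in> Q\}$ both multiply the probability of
  a vector $(x_1, \dots, x_n)$ by a function of its sum, namely by a multiple of
  $\lambda^k 1_Q(k)$ at $k = x_1 + \dots + x_n$. Hence all the conditional laws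
  that occur share the same conditional law of the vector given $S_n = k$, and only the law of
  $S_n$ differs.

  Given $S_n = k$, the vector increases stochastically with $k$. This is Efron's theorem
  (\<open>efron\<close>), which is where the inequality of log-concavity enters. It is proved by induction
  on $n$ from the case of two summands $a + b = k$ (\<open>rel_pmf_split_law\<close>), where the quantile coupling
  makes both summands nondecreasing in $k$ at once. The induction needs that the
  law of a sum is again log-concave (\<open>pf2_convolution\<close>, by the Cauchy--Binet formula).

  The laws of $S_n$ under two of the conditionings are ordered in likelihood ratio, hence
  coupled monotonically (\<open>rel_pmf_le_of_lr\<close>); combined with Efron's theorem
  this couples the vectors (\<open>rel_pmf_reweight\<close>). The entries after the $n$th are independent of the
  conditioning and individually increasing in $\lambda$, so they are coupled one by one
  (\<open>stoch_le_overwrite\<close>). All five claims become instances of \<open>cond_law_tilt_mono\<close>.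

  Couplings of discrete laws are expressed by the relator \<^const>\<open>rel_pmf\<close>: \<open>rel_pmf R p q\<close> holds iff
  some coupling of \<open>p\<close> and \<open>q\<close> is supported in \<open>R\<close>.
\<close>

section \<open>Quantile coupling and likelihood ratio order\<close>

definition quantile :: "nat pmf \<Rightarrow> real \<Rightarrow> nat" where
  "quantile p u = (LEAST t. u \<le> measure_pmf.prob p {..t})"

text \<open>
  The condition $u < 1$ guarantees that the set over which the minimum is taken is not empty.
\<close>

lemma quantile_le_iff:
  assumes "u < 1"
  shows "quantile p u \<le> t \<longleftrightarrow> u \<le> measure_pmf.prob p {..t}"
proof
  have "(\<lambda>t. measure_pmf.prob p {..t}) \<longlonglongrightarrow> measure_pmf.prob p (\<Union>t. {..t})"
    by (rule measure_pmf.finite_Lim_measure_incseq) (auto simp: incseq_def)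
  moreover have "(\<Union>t. {..t}) = (UNIV :: nat set)" by auto
  ultimately have "(\<lambda>t. measure_pmf.prob p {..t}) \<longlonglongrightarrow> 1" by simp
  then have "eventually (\<lambda>t. u < measure_pmf.prob p {..t}) sequentially"
    using assms by (rule order_tendstoD(1))
  then obtain s where "u \<le> measure_pmf.prob p {..s}"
    by (auto simp: eventually_sequentially intro: less_imp_le)
  then have "u \<le> measure_pmf.prob p {..quantile p u}"
    unfolding quantile_def by (rule LeastI)
  then show "u \<le> measure_pmf.prob p {..t}" if "quantile p u \<le> t"
    using that measure_pmf.finite_measure_mono[of "{..quantile p u}" "{..t}" p] by force
  show "quantile p u \<le> t" if "u \<le> measure_pmf.prob p {..t}"
    unfolding quantile_def using that by (rule Least_le)
qed

lemma measurable_quantile [measurable]: "quantile p \<in> borel \<rightarrow>\<^sub>M count_space UNIV"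
  unfolding quantile_def by measurable

lemma prob_atMost_eqI:
  fixes p q :: "nat pmf"
  assumes "\<And>t. measure_pmf.prob p {..t} = measure_pmf.prob q {..t}"
  shows "p = q"
proof (rule pmf_eqI)
  fix x
  have pmf_diff: "pmf r x = measure_pmf.prob r {..x} - (if x = 0 then 0 else measure_pmf.prob r {..x - 1})" for r :: "nat pmf"
  proof (cases x)
    case 0
    then have "{..x} = {x}" by auto
    then show ?thesis using 0 by (simp add: measure_pmf_single)
  next
    case (Suc y)
    have "measure_pmf.prob r ({..y} \<union> {x}) = measure_pmf.prob r {..y} + measure_pmf.prob r {x}"
      using Suc by (intro measure_pmf.finite_measure_Union) auto
    moreover have "{..x} = {..y} \<union> {x}" using Suc by auto
    ultimately show ?thesis using Suc by (simp add: measure_pmf_single)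
  qed
  show "pmf p x = pmf q x"
    using assms by (simp add: pmf_diff[of p] pmf_diff[of q])
qed

text \<open>
  Feeding one uniform variable into both quantile functions couples \<open>p\<close> and \<open>q\<close>, so every
  relation that holds between the two quantiles level by level is realised by a coupling.
\<close>

lemma rel_pmf_quantile:
  assumes R: "\<And>u. 0 < u \<Longrightarrow> u < 1 \<Longrightarrow> R (quantile p u) (quantile q u)"
  shows "rel_pmf R p q"
proof -
  define U where "U = uniform_measure lborel {0<..<1::real}"
  have U: "prob_space U"
    unfolding U_def by (rule prob_space_uniform_measure) auto
  have setsU [measurable_cong]: "sets U = sets borel" by (simp add: U_def)
  define f where "f u = (quantile p u, quantile q u)" for u
  have f [measurable]: "f \<in> U \<rightarrow>\<^sub>M count_space UNIV"
  proof -
    have "f \<in> U \<rightarrow>\<^sub>M count_space UNIV \<Otimes>\<^sub>M count_space UNIV"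
      unfolding f_def by measurable
    then show ?thesis by (simp add: pair_measure_countable)
  qed
  interpret D: prob_space "distr U (count_space UNIV) f"
    using U f by (rule prob_space.prob_space_distr)
  define c where "c = Abs_pmf (distr U (count_space UNIV) f)"
  have "AE x in distr U (count_space UNIV) f. measure (distr U (count_space UNIV) f) {x} \<noteq> 0"
    by (subst D.AE_support_countable) (auto intro!: exI[of _ UNIV])
  then have c: "measure_pmf c = distr U (count_space UNIV) f"
    unfolding c_def using D.prob_space_axioms by (intro Abs_pmf_inverse) auto
  have cdf: "measure U {u. quantile r u \<le> t} = measure_pmf.prob r {..t}" for r t
  proof -
    let ?F = "measure_pmf.prob r {..t}"
    have meas: "{u. quantile r u \<le> t} \<in> sets lborel"
      by measurable
    have F: "0 \<le> ?F" "?F \<le> 1" by auto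
    have "measure U {u. quantile r u \<le> t} = measure lborel ({0<..<1} \<inter> {u. quantile r u \<le> t})"
      unfolding U_def using meas by (subst measure_uniform_measure) auto
    also have "{0<..<1} \<inter> {u. quantile r u \<le> t} = (if ?F < 1 then {0<..?F} else {0<..<1})"
      using F by (auto simp: quantile_le_iff)
    also have "measure lborel \<dots> = ?F"
      using F by (auto simp: not_less intro: antisym)
    finally show ?thesis .
  qed
  have spU: "space U = UNIV" by (simp add: U_def)
  show ?thesis
  proof (rule rel_pmf.intros)
    show "map_pmf fst c = p"
    proof (rule prob_atMost_eqI)
      fix t
      have "measure_pmf.prob (map_pmf fst c) {..t} = measure_pmf.prob c (fst -` {..t})"
        by simp
      also have "\<dots> = measure U (f -` (fst -` {..t}) \<inter> space U)"
        unfolding c by (rule measure_distr) auto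
      also have "f -` (fst -` {..t}) \<inter> space U = {u. quantile p u \<le> t}"
        by (auto simp: f_def spU)
      finally show "measure_pmf.prob (map_pmf fst c) {..t} = measure_pmf.prob p {..t}"
        by (simp add: cdf)
    qed
    show "map_pmf snd c = q"
    proof (rule prob_atMost_eqI)
      fix t
      have "measure_pmf.prob (map_pmf snd c) {..t} = measure_pmf.prob c (snd -` {..t})"
        by simp
      also have "\<dots> = measure U (f -` (snd -` {..t}) \<inter> space U)"
        unfolding c by (rule measure_distr) auto
      also have "f -` (snd -` {..t}) \<inter> space U = {u. quantile q u \<le> t}"
        by (auto simp: f_def spU)
      finally show "measure_pmf.prob (map_pmf snd c) {..t} = measure_pmf.prob q {..t}"
        by (simp add: cdf)
    qed
    fix x y assume "(x, y) \<in> set_pmf c"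
    then have "measure_pmf.prob c {(x, y)} > 0"
      by (simp add: measure_pmf_single pmf_positive)
    moreover have "measure_pmf.prob c {(x, y)} = measure U ({0<..<1} \<inter> (f -` {(x, y)}))"
    proof -
      have "f -` {(x, y)} \<in> sets lborel"
        using measurable_sets[OF f, of "{(x, y)}"] spU by (simp add: setsU)
      then have "measure U (f -` {(x, y)}) = measure U ({0<..<1} \<inter> (f -` {(x, y)}))"
        unfolding U_def by (auto simp: measure_uniform_measure simp flip: Int_assoc)
      then show ?thesis
        unfolding c by (simp add: measure_distr spU)
    qed
    ultimately have "{0<..<1} \<inter> (f -` {(x, y)}) \<noteq> {}"
      by (intro notI) simp
    then show "R x y"
      using R by (auto simp: f_def)
  qed
qed

text \<open>
  Let $X$ and $Y$ have the laws \<open>p\<close> and \<open>q\<close>. Summing the likelihood ratio inequality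
  over $x \<le> t < y$ gives
  $P(Y \<le> t)\,P(X > t) \<le> P(X \<le> t)\,P(Y > t)$, and writing $P(\cdot > t) = 1 - P(\cdot \<le> t)$
  turns this into a comparison of the distribution functions. The cross-multiplied form
  of the hypothesis avoids any case distinction on the supports.
\<close>

lemma prob_atMost_antimono_of_lr:
  fixes p q :: "nat pmf"
  assumes lr: "\<And>x y. x < y \<Longrightarrow> pmf p y * pmf q x \<le> pmf p x * pmf q y"
  shows "measure_pmf.prob q {..t} \<le> measure_pmf.prob p {..t}"
proof -
  have compl: "measure_pmf.prob r {t<..} = 1 - measure_pmf.prob r {..t}" for r :: "nat pmf"
    using measure_pmf.prob_compl[of "{..t}" r] by (auto simp: Compl_eq_Diff_UNIV[symmetric] not_le Compl_atMost)
  have prod: "measure_pmf.prob r {..t} * measure_pmf.prob s {t<..} = measure_pmf.prob (pair_pmf r s) ({..t} \<times> {t<..})"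
    for r s :: "nat pmf"
    by (simp add: measure_pmf_prob_product)
  have "measure_pmf.prob (pair_pmf q p) ({..t} \<times> {t<..}) \<le> measure_pmf.prob (pair_pmf p q) ({..t} \<times> {t<..})"
    unfolding measure_pmf_conv_infsetsum
    by (rule infsetsum_mono) (auto simp: pmf_pair pmf_abs_summable mult.commute intro!: lr)
  then have "measure_pmf.prob q {..t} * (1 - measure_pmf.prob p {..t}) \<le> measure_pmf.prob p {..t} * (1 - measure_pmf.prob q {..t})"
    by (simp add: prod[symmetric] compl)
  then show ?thesis by (simp add: algebra_simps)
qed

lemma quantile_mono_of_lr:
  fixes p q :: "nat pmf"
  assumes lr: "\<And>x y. x < y \<Longrightarrow> pmf p y * pmf q x \<le> pmf p x * pmf q y"
    and u: "u < 1"
  shows "quantile p u \<le> quantile q u"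
proof -
  have "u \<le> measure_pmf.prob q {..quantile q u}"
    using quantile_le_iff[OF u, of q] by blast
  also have "\<dots> \<le> measure_pmf.prob p {..quantile q u}"
    using lr by (rule prob_atMost_antimono_of_lr)
  finally show ?thesis
    using u by (simp add: quantile_le_iff)
qed

lemma rel_pmf_le_of_lr:
  fixes p q :: "nat pmf"
  assumes "\<And>x y. x < y \<Longrightarrow> pmf p y * pmf q x \<le> pmf p x * pmf q y"
  shows "rel_pmf (\<le>) p q"
  using assms by (intro rel_pmf_quantile quantile_mono_of_lr) auto

text \<open>
  If \<open>q\<close> lies between \<open>p\<close> and \<open>p\<close> shifted by \<open>d\<close>, then one and the same coupling, the
  quantile coupling, realises both comparisons. Two unrelated couplings would not do: in the
  application the first comparison keeps one summand monotone and the second one the other.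
\<close>

lemma rel_pmf_interlace_of_lr:
  fixes p q :: "nat pmf"
  assumes lr: "\<And>x y. x < y \<Longrightarrow> pmf p y * pmf q x \<le> pmf p x * pmf q y"
    and lr_shift: "\<And>x y. x < y \<Longrightarrow>
      pmf q y * pmf (map_pmf (\<lambda>x. x + d) p) x \<le> pmf q x * pmf (map_pmf (\<lambda>x. x + d) p) y"
  shows "rel_pmf (\<lambda>x y. x \<le> y \<and> y \<le> x + d) p q"
proof (rule rel_pmf_quantile)
  fix u :: real assume "0 < u" and u: "u < 1"
  have "quantile p u \<le> quantile q u"
    using lr u by (rule quantile_mono_of_lr)
  moreover have "quantile q u \<le> quantile (map_pmf (\<lambda>x. x + d) p) u"
    using lr_shift u by (rule quantile_mono_of_lr)
  moreover have "quantile (map_pmf (\<lambda>x. x + d) p) u \<le> quantile p u + d"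
  proof -
    have "(\<lambda>x. x + d) -` {..quantile p u + d} = {..quantile p u}" by auto
    moreover have "u \<le> measure_pmf.prob p {..quantile p u}"
      using quantile_le_iff[OF u, of p] by blast
    ultimately show ?thesis
      by (simp add: quantile_le_iff[OF u])
  qed
  ultimately show "quantile p u \<le> quantile q u \<and> quantile q u \<le> quantile p u + d"
    by simp
qed

section \<open>Log-concave sequences\<close>

text \<open>
  Polya frequency sequences of order two. This four-point form of log-concavity contains the
  absence of internal zeros and needs no division; it is stable under convolution, whereas
  $f(x-1) f(x+1) \<le> f(x)^2$ alone is not.
\<close>

definition pf2 :: "(nat \<Rightarrow> real) \<Rightarrow> bool" where
  "pf2 f \<longleftrightarrow> (\<forall>a. 0 \<le> f a) \<and> (\<forall>a s t. f a * f (a + s + t) \<le> f (a + s) * f (a + t))"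

definition toeplitz :: "(nat \<Rightarrow> real) \<Rightarrow> nat \<Rightarrow> nat \<Rightarrow> real" where
  "toeplitz f i j = (if j \<le> i then f (i - j) else 0)"

lemma pf2_nonneg: "pf2 f \<Longrightarrow> 0 \<le> f a"
  by (simp add: pf2_def)

text \<open>
  A nonnegative sequence is \<open>pf2\<close> iff the $2 \times 2$ minors of its lower triangular Toeplitz matrix are
  nonnegative. In this form the condition also covers the indices outside the support.
\<close>

lemma toeplitz_minor_nonneg:
  assumes "pf2 f" "i \<le> i'" "j \<le> j'"
  shows "toeplitz f i j' * toeplitz f i' j \<le> toeplitz f i j * toeplitz f i' j'"
proof (cases "j' \<le> i")
  case True
  have "f (i - j') * f ((i - j') + (j' - j) + (i' - i)) \<le> f ((i - j') + (j' - j)) * f ((i - j') + (i' - i))"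
    using assms(1) unfolding pf2_def by blast
  then show ?thesis
    using True assms(2,3) by (simp add: toeplitz_def)
next
  case False
  then show ?thesis
    using assms by (auto simp: toeplitz_def pf2_def)
qed

text \<open>
  The Toeplitz matrix of a convolution is the product of the Toeplitz matrices, and by the
  Cauchy--Binet formula the $2 \times 2$ minors of a product are sums of products of minors.
  Instead of summing over $l < m$, the proof sums over all pairs $(l, m)$, which
  counts every product of minors twice.
\<close>

lemma pf2_convolution:
  assumes f: "pf2 f" and g: "pf2 g"
  shows "pf2 (\<lambda>k. \<Sum>a\<le>k. f a * g (k - a))"
proof -
  define h where "h k = (\<Sum>a\<le>k. f a * g (k - a))" for k
  have h_toeplitz: "toeplitz h i j = (\<Sum>l\<le>N. toeplitz f i l * toeplitz g l j)" if "i \<le> N" for i j N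
  proof (cases "j \<le> i")
    case True
    have "(\<Sum>l\<le>N. toeplitz f i l * toeplitz g l j) = (\<Sum>l\<in>{j..i}. f (i - l) * g (l - j))"
      using that by (intro sum.mono_neutral_cong_right) (auto simp: toeplitz_def)
    also have "\<dots> = (\<Sum>a\<le>i - j. f a * g (i - j - a))"
      using True by (intro sum.reindex_bij_witness[of _ "\<lambda>a. i - a" "\<lambda>l. i - l"]) auto
    finally show ?thesis
      using True by (simp add: toeplitz_def h_def)
  next
    case False
    then show ?thesis
      by (auto simp: toeplitz_def intro!: sum.neutral)
  qed
  have minor: "toeplitz h i j' * toeplitz h i' j \<le> toeplitz h i j * toeplitz h i' j'"
    if le: "i \<le> i'" "j \<le> j'" for i i' j j'
  proof -
    let ?F = "toeplitz f" and ?G = "toeplitz g" and ?I = "{..i'}"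
    have prod: "toeplitz h i u * toeplitz h i' v
        = (\<Sum>l\<in>?I. \<Sum>m\<in>?I. ?F i l * ?F i' m * (?G l u * ?G m v))" for u v
      unfolding h_toeplitz[OF le(1)] h_toeplitz[of i' i', OF order_refl] sum_product by (simp add: mult_ac)
    have swap: "(\<Sum>l\<in>?I. \<Sum>m\<in>?I. ?F i l * ?F i' m * (?G l u * ?G m v))
        = (\<Sum>l\<in>?I. \<Sum>m\<in>?I. ?F i m * ?F i' l * (?G m u * ?G l v))" for u v
      by (rule sum.swap)
    have "0 \<le> (\<Sum>l\<in>?I. \<Sum>m\<in>?I. (?F i l * ?F i' m - ?F i m * ?F i' l)
        * (?G l j * ?G m j' - ?G l j' * ?G m j))"
    proof (intro sum_nonneg)
      fix l m
      show "0 \<le> (?F i l * ?F i' m - ?F i m * ?F i' l) * (?G l j * ?G m j' - ?G l j' * ?G m j)"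
      \<comment> \<open>Both factors change sign together when \<open>l\<close> and \<open>m\<close> are exchanged.\<close>
      proof (cases "l \<le> m")
        case True
        then show ?thesis
          using toeplitz_minor_nonneg[OF f le(1) True] toeplitz_minor_nonneg[OF g True le(2)]
          by (intro mult_nonneg_nonneg) auto
      next
        case False
        then show ?thesis
          using toeplitz_minor_nonneg[OF f le(1), of m l] toeplitz_minor_nonneg[OF g _ le(2), of m l]
          by (intro mult_nonpos_nonpos) (auto simp: mult_ac)
      qed
    qed
    also have "\<dots> = 2 * (toeplitz h i j * toeplitz h i' j' - toeplitz h i j' * toeplitz h i' j)"
    proof -
      have "(\<Sum>l\<in>?I. \<Sum>m\<in>?I. (?F i l * ?F i' m - ?F i m * ?F i' l)
            * (?G l j * ?G m j' - ?G l j' * ?G m j))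
          = (\<Sum>l\<in>?I. \<Sum>m\<in>?I. ?F i l * ?F i' m * (?G l j * ?G m j'))
          - (\<Sum>l\<in>?I. \<Sum>m\<in>?I. ?F i l * ?F i' m * (?G l j' * ?G m j))
          + (\<Sum>l\<in>?I. \<Sum>m\<in>?I. ?F i m * ?F i' l * (?G m j * ?G l j'))
          - (\<Sum>l\<in>?I. \<Sum>m\<in>?I. ?F i m * ?F i' l * (?G m j' * ?G l j))"
        unfolding sum_subtractf[symmetric] sum.distrib[symmetric]
        by (intro sum.cong refl) (simp add: algebra_simps)
      then show ?thesis
        unfolding prod swap[symmetric] by simp
    qed
    finally show ?thesis by simp
  qed
  have "pf2 h"
    unfolding pf2_def
  proof (intro conjI allI)
    fix a s t
    show "0 \<le> h a"
      using f g by (auto simp: h_def pf2_nonneg intro!: sum_nonneg)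
    show "h a * h (a + s + t) \<le> h (a + s) * h (a + t)"
      using minor[of "a + s" "a + s + t" 0 s] by (simp add: toeplitz_def add.commute)
  qed
  then show ?thesis by (simp add: h_def[abs_def])
qed

text \<open>
  Log-concavity makes the ratios $f(x+1)/f(x)$ decreasing on the support, which is an initial
  segment; the four-point inequality is the telescoped product of these comparisons.
\<close>

lemma log_concave_imp_pf2:
  assumes "log_concave p"
  shows "pf2 (pmf p)"
proof -
  let ?f = "pmf p"
  have below: "0 < ?f x" if "x \<le> y" "0 < ?f y" for x y
  proof -
    have "enat y \<le> max_supp p"
      unfolding max_supp_def using that(2) by (intro Sup_upper) auto
    then have "enat x \<le> max_supp p"
      using that(1) by (metis enat_ord_simps(1) order_trans)
    then show ?thesis using assms by (simp add: log_concave_def)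
  qed
  have step: "?f x * ?f (x + 2) \<le> ?f (x + 1) * ?f (x + 1)" for x
  proof (cases "?f (x + 2) = 0")
    case False
    then have pos: "0 < ?f (x + 2)" "0 < ?f (x + 1)" "0 < ?f x"
      using below[of _ "x + 2"] by (auto simp: less_le)
    have "enat (x + 2) \<le> max_supp p"
      unfolding max_supp_def using pos(1) by (intro Sup_upper) auto
    then have "enat (x + 1) < max_supp p"
      by (metis enat_ord_simps(2) order_less_le_trans add_strict_left_mono one_less_numeral_iff semiring_norm(76))
    then have "?f x / ?f (x + 1) \<le> ?f (x + 1) / ?f (x + 2)"
      using assms unfolding log_concave_def by (metis One_nat_def add.commute add_2_eq_Suc add_diff_cancel_right' add_is_0 gr_zeroI plus_1_eq_Suc zero_neq_one)
    then show ?thesis using pos by (simp add: field_simps)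
  qed simp
  have ratio: "?f a * ?f (a + t + 1) \<le> ?f (a + 1) * ?f (a + t)" for a t
  proof (induction t)
    case (Suc t)
    show ?case
    proof (cases "?f (a + t + 2) = 0")
      case False
      then have pos: "0 < ?f (a + t)"
        using below[of "a + t" "a + t + 2"] by (auto simp: less_le)
      have "?f (a + t) * (?f a * ?f (a + t + 2)) \<le> ?f a * (?f (a + t + 1) * ?f (a + t + 1))"
        using mult_left_mono[OF step[of "a + t"], of "?f a"] by (simp add: mult_ac)
      also have "\<dots> \<le> ?f (a + t) * (?f (a + 1) * ?f (a + t + 1))"
        using mult_right_mono[OF Suc.IH, of "?f (a + t + 1)"] by (simp add: mult_ac)
      finally show ?thesis using pos by simp
    qed simp
  qed simp
  have "?f a * ?f (a + s + t) \<le> ?f (a + s) * ?f (a + t)" for a s t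
  proof (induction s)
    case (Suc s)
    show ?case
    proof (cases "?f (a + s + t + 1) = 0")
      case False
      then have pos: "0 < ?f (a + s)" "0 < ?f (a + s + t)"
        using below[of _ "a + s + t + 1"] by (auto simp: less_le)
      have "?f (a + s) * ?f (a + s + t) * (?f a * ?f (a + s + t + 1))
          = (?f a * ?f (a + s + t)) * (?f (a + s) * ?f (a + s + t + 1))"
        by (simp add: mult_ac)
      also have "\<dots> \<le> (?f (a + s) * ?f (a + t)) * (?f (a + s + 1) * ?f (a + s + t))"
        by (intro mult_mono Suc.IH ratio) auto
      also have "\<dots> = ?f (a + s) * ?f (a + s + t) * (?f (a + s + 1) * ?f (a + t))"
        by (simp add: mult_ac)
      finally show ?thesis using pos by simp
    qed simp
  qed simp
  then show ?thesis by (simp add: pf2_def)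
qed

section \<open>Mixtures and conditioning\<close>

lemma rel_pmf_bindI_supp:
  assumes "rel_pmf R p q"
    and "\<And>x y. R x y \<Longrightarrow> x \<in> set_pmf p \<Longrightarrow> y \<in> set_pmf q \<Longrightarrow> rel_pmf P (f x) (g y)"
  shows "rel_pmf P (bind_pmf p f) (bind_pmf q g)"
proof (rule rel_pmf_bindI)
  show "rel_pmf (\<lambda>x y. R x y \<and> x \<in> set_pmf p \<and> y \<in> set_pmf q) p q"
    using assms(1) by (rule pmf.rel_mono_strong) auto
qed (use assms(2) in auto)

lemma cond_bind_pmf:
  assumes ne: "set_pmf p \<inter> B \<noteq> {}"
    and inside: "\<And>x. x \<in> set_pmf p \<Longrightarrow> x \<in> B \<Longrightarrow> set_pmf (K x) \<subseteq> A"
    and outside: "\<And>x. x \<in> set_pmf p \<Longrightarrow> x \<notin> B \<Longrightarrow> set_pmf (K x) \<inter> A = {}"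
  shows "cond_pmf (bind_pmf p K) A = bind_pmf (cond_pmf p B) K"
proof (rule pmf_eqI)
  fix y
  have ne': "set_pmf (bind_pmf p K) \<inter> A \<noteq> {}"
    using ne inside set_pmf_not_empty by (fastforce simp: set_bind_pmf)
  have "emeasure (bind_pmf p K) A = (\<integral>\<^sup>+x. indicator B x \<partial>p)"
  proof -
    have "emeasure (K x) A = indicator B x" if "x \<in> set_pmf p" for x
    proof (cases "x \<in> B")
      case True
      then have "AE y in K x. y \<in> A" using inside[OF that] by (auto simp: AE_measure_pmf_iff)
      then show ?thesis using True by (simp add: measure_pmf.emeasure_eq_1_AE)
    next
      case False
      then have "emeasure (K x) (A \<inter> set_pmf (K x)) = 0" using outside[OF that] by (simp add: Int_commute)
      then show ?thesis using False by (simp add: emeasure_Int_set_pmf)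
    qed
    then show ?thesis
      unfolding emeasure_bind_pmf by (intro nn_integral_cong_AE) (simp add: AE_measure_pmf_iff)
  qed
  then have norm: "measure (bind_pmf p K) A = measure p B"
    by (simp add: measure_def)
  have "ennreal (pmf (bind_pmf (cond_pmf p B) K) y) = (\<integral>\<^sup>+x. ennreal (pmf (K x) y) * indicator B x \<partial>p) / emeasure p B"
    by (simp add: ennreal_pmf_bind cond_pmf.rep_eq[OF ne] nn_integral_uniform_measure)
  also have "(\<integral>\<^sup>+x. ennreal (pmf (K x) y) * indicator B x \<partial>p) = (\<integral>\<^sup>+x. ennreal (pmf (K x) y) * indicator A y \<partial>p)"
    using inside outside
    by (intro nn_integral_cong_AE) (auto simp: AE_measure_pmf_iff indicator_def pmf_eq_0_set_pmf)
  also have "\<dots> = ennreal (pmf (bind_pmf p K) y) * indicator A y"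
    by (simp add: ennreal_pmf_bind nn_integral_multc)
  finally show "pmf (cond_pmf (bind_pmf p K) A) y = pmf (bind_pmf (cond_pmf p B) K) y"
    using measure_measure_pmf_not_zero[OF ne]
    by (auto simp: pmf_cond[OF ne'] norm measure_pmf.emeasure_eq_measure divide_ennreal
        zero_less_measure_iff indicator_def split: if_splits)
qed

lemma disintegrate_pmf: "p = bind_pmf (map_pmf T p) (\<lambda>k. cond_pmf p {v. T v = k})"
proof -
  have "bind_pmf (map_pmf T p) (\<lambda>k. cond_pmf p {v. k = T v}) = p"
  proof (rule bind_cond_pmf_cancel)
    fix k v assume "k = T v"
    have "T -` {k'. k' = T v} = {w. k = T w}" using \<open>k = T v\<close> by auto
    then show "measure_pmf.prob p {w. k = T w} = measure_pmf.prob (map_pmf T p) {k'. k' = T v}"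
      by simp
  qed auto
  then show ?thesis by (simp add: eq_commute)
qed

text \<open>
  Only values \<open>k\<close> of positive probability matter, because \<^const>\<open>cond_pmf\<close> is unspecified on
  null events.
\<close>

definition fibrewise_increasing :: "'a::ord pmf \<Rightarrow> ('a \<Rightarrow> nat) \<Rightarrow> bool" where
  "fibrewise_increasing p T \<longleftrightarrow> (\<forall>k k'. k \<le> k' \<longrightarrow> k \<in> T ` set_pmf p \<longrightarrow> k' \<in> T ` set_pmf p \<longrightarrow>
     rel_pmf (\<le>) (cond_pmf p {v. T v = k}) (cond_pmf p {v. T v = k'}))"

section \<open>Two summands given their sum\<close>

definition add_law :: "nat pmf \<Rightarrow> nat pmf \<Rightarrow> nat pmf" where
  "add_law p q = map_pmf (\<lambda>(a, b). a + b) (pair_pmf p q)"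

definition split_law :: "nat pmf \<Rightarrow> nat pmf \<Rightarrow> nat \<Rightarrow> (nat \<times> nat) pmf" where
  "split_law p q k = cond_pmf (pair_pmf p q) {(a, b). a + b = k}"

lemma pmf_add_law: "pmf (add_law p q) k = (\<Sum>a\<le>k. pmf p a * pmf q (k - a))"
proof -
  have "(\<lambda>(a, b). a + b) -` {k} = (\<lambda>a. (a, k - a)) ` {..k}" by force
  then have "pmf (add_law p q) k = measure (pair_pmf p q) ((\<lambda>a. (a, k - a)) ` {..k})"
    unfolding add_law_def by (simp add: pmf_map)
  also have "\<dots> = (\<Sum>a\<le>k. pmf p a * pmf q (k - a))"
    by (subst measure_measure_pmf_finite) (auto simp: sum.reindex inj_on_def pmf_pair)
  finally show ?thesis .
qed

lemma pf2_add_law: "pf2 (pmf p) \<Longrightarrow> pf2 (pmf q) \<Longrightarrow> pf2 (pmf (add_law p q))"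
  using pf2_convolution[of "pmf p" "pmf q"] by (simp add: pmf_add_law[abs_def])

lemma split_law_supp:
  assumes "k \<in> set_pmf (add_law p q)"
  shows "set_pmf (pair_pmf p q) \<inter> {(a, b). a + b = k} \<noteq> {}"
  using assms by (auto simp: add_law_def)

lemma pmf_fst_split_law:
  assumes "k \<in> set_pmf (add_law p q)"
  shows "pmf (map_pmf fst (split_law p q k)) a = pmf p a * toeplitz (pmf q) k a / pmf (add_law p q) k"
proof -
  note ne = split_law_supp[OF assms]
  have norm: "measure_pmf.prob (pair_pmf p q) {(a, b). a + b = k} = pmf (add_law p q) k"
    unfolding add_law_def pmf_map by (rule arg_cong[where f = "measure_pmf.prob _"]) auto
  have "pmf (map_pmf fst (split_law p q k)) a = measure (split_law p q k) (fst -` {a})"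
    by (simp add: pmf_map)
  also have "\<dots> = measure (split_law p q k) (if a \<le> k then {(a, k - a)} else {})"
  proof (rule measure_pmf.finite_measure_eq_AE)
    show "AE x in measure_pmf (split_law p q k). (x \<in> fst -` {a}) = (x \<in> (if a \<le> k then {(a, k - a)} else {}))"
      by (auto simp: AE_measure_pmf_iff split_law_def set_cond_pmf[OF ne])
  qed auto
  also have "\<dots> = pmf p a * toeplitz (pmf q) k a / pmf (add_law p q) k"
    by (auto simp: measure_pmf_single split_law_def pmf_cond[OF ne] norm pmf_pair toeplitz_def)
  finally show ?thesis .
qed

text \<open>
  Efron's theorem for two summands, in a joint form. Given $a + b = k$, the law of $a$ has
  weights $p(a)\,q(k - a)$. Total positivity of \<open>q\<close> orders these laws in likelihood ratio as
  \<open>k\<close> grows to \<open>k + d\<close>; total positivity of \<open>p\<close> shows that $a$ grows by at most \<open>d\<close> in the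
  same sense. The quantile coupling then satisfies $a \<le> a' \<le> a + d$, which says that
  neither summand decreases.
\<close>

lemma rel_pmf_split_law:
  assumes p: "pf2 (pmf p)" and q: "pf2 (pmf q)" and "k \<le> k'"
    and k: "k \<in> set_pmf (add_law p q)" and k': "k' \<in> set_pmf (add_law p q)"
  shows "rel_pmf (\<lambda>(a, b) (a', b'). a \<le> a' \<and> b \<le> b') (split_law p q k) (split_law p q k')"
proof -
  define d where "d = k' - k"
  then have d: "k' = k + d" using \<open>k \<le> k'\<close> by simp
  let ?A = "\<lambda>k. map_pmf fst (split_law p q k)"
  let ?h = "pmf (add_law p q)"
  have h: "0 < ?h k" "0 < ?h k'" using k k' by (auto simp: pmf_positive)
  have "rel_pmf (\<lambda>a a'. a \<le> a' \<and> a' \<le> a + d) (?A k) (?A k')"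
  proof (rule rel_pmf_interlace_of_lr)
    fix x y :: nat assume "x < y"
    have "pmf p x * pmf p y * (toeplitz (pmf q) k y * toeplitz (pmf q) k' x)
        \<le> pmf p x * pmf p y * (toeplitz (pmf q) k x * toeplitz (pmf q) k' y)"
      using \<open>x < y\<close> \<open>k \<le> k'\<close> by (intro mult_left_mono toeplitz_minor_nonneg q) auto
    then show "pmf (?A k) y * pmf (?A k') x \<le> pmf (?A k) x * pmf (?A k') y"
      using h by (simp add: pmf_fst_split_law k k' divide_right_mono mult_ac)
    have shift: "pmf (map_pmf (\<lambda>a. a + d) (?A k)) z = (if d \<le> z then pmf (?A k) (z - d) else 0)" for z
    proof (cases "d \<le> z")
      case True
      then show ?thesis
        using pmf_map_inj'[of "\<lambda>a. a + d" "?A k" "z - d"] by (simp add: inj_on_def)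
    next
      case False
      then show ?thesis by (auto simp: pmf_eq_0_set_pmf)
    qed
    show "pmf (?A k') y * pmf (map_pmf (\<lambda>a. a + d) (?A k)) x
        \<le> pmf (?A k') x * pmf (map_pmf (\<lambda>a. a + d) (?A k)) y"
    proof (cases "d \<le> x")
      case True
      let ?Q = "toeplitz (pmf q)"
      have Q: "?Q k (z - d) = ?Q k' z" if "d \<le> z" for z
        using that by (auto simp: toeplitz_def d)
      \<comment> \<open>By \<open>Q\<close>, shifting by \<open>d\<close> turns the factors of \<open>q\<close> at total \<open>k\<close>
        into those at total \<open>k'\<close>, so only \<open>p\<close> remains to be compared.\<close>
      have "pmf p (x - d) * pmf p ((x - d) + (y - x) + d) \<le> pmf p ((x - d) + (y - x)) * pmf p ((x - d) + d)"
        using p unfolding pf2_def by blast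
      then have "pmf p y * pmf p (x - d) \<le> pmf p x * pmf p (y - d)"
        using True \<open>x < y\<close> by (simp add: mult_ac)
      then have "(?Q k' x * ?Q k' y) * (pmf p y * pmf p (x - d)) \<le> (?Q k' x * ?Q k' y) * (pmf p x * pmf p (y - d))"
        using q by (intro mult_left_mono) (auto simp: toeplitz_def)
      then show ?thesis
        using True \<open>x < y\<close> h by (simp add: shift pmf_fst_split_law k k' Q divide_right_mono mult_ac)
    qed (simp add: shift)
  qed
  then have "rel_pmf (\<lambda>x x'. fst x \<le> fst x' \<and> fst x' \<le> fst x + d) (split_law p q k) (split_law p q k')"
    by (simp add: pmf.rel_map)
  then show ?thesis
  proof (rule pmf.rel_mono_strong)
    have sum: "fst x + snd x = j" if "x \<in> set_pmf (split_law p q j)" "j \<in> set_pmf (add_law p q)" for x j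
      using that(1) unfolding split_law_def set_cond_pmf[OF split_law_supp[OF that(2)]] by auto
    fix x x' assume "x \<in> set_pmf (split_law p q k)" "x' \<in> set_pmf (split_law p q k')"
      "fst x \<le> fst x' \<and> fst x' \<le> fst x + d"
    then show "(\<lambda>(a, b) (a', b'). a \<le> a' \<and> b \<le> b') x x'"
      using sum[OF _ k, of x] sum[OF _ k', of x'] by (auto simp: d case_prod_unfold)
  qed
qed

section \<open>Efron's theorem\<close>

text \<open>
  Vectors of length \<open>n\<close> are sequences that vanish from index \<open>n\<close> on, so that all lengths share
  one discrete type with its coordinatewise order.
\<close>

definition vec_law :: "(nat \<Rightarrow> nat pmf) \<Rightarrow> nat \<Rightarrow> (nat \<Rightarrow> nat) pmf" where
  "vec_law \<mu> n = Pi_pmf {..<n} 0 \<mu>"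

definition prefix_sum :: "nat \<Rightarrow> (nat \<Rightarrow> nat) \<Rightarrow> nat" where
  "prefix_sum n v = (\<Sum>i<n. v i)"

lemma prefix_sum_upd [simp]: "prefix_sum (Suc n) (v(n := b)) = prefix_sum n v + b"
  by (auto simp: prefix_sum_def intro!: sum.cong)

text \<open>
  Grouping the first \<open>n\<close> entries by their sum turns the law into a mixture over pairs whose sum is
  the total, so that conditioning on the total becomes conditioning of the mixing pair.
\<close>

lemma vec_law_Suc:
  "vec_law \<mu> (Suc n) = bind_pmf (pair_pmf (map_pmf (prefix_sum n) (vec_law \<mu> n)) (\<mu> n))
     (\<lambda>(a, b). map_pmf (\<lambda>v. v(n := b)) (cond_pmf (vec_law \<mu> n) {v. prefix_sum n v = a}))"
proof -
  let ?V = "vec_law \<mu> n"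
  have "vec_law \<mu> (Suc n) = bind_pmf (\<mu> n) (\<lambda>b. map_pmf (\<lambda>v. v(n := b)) ?V)"
    unfolding vec_law_def lessThan_Suc
    by (subst Pi_pmf_insert) (auto simp: pair_pmf_def map_bind_pmf map_pmf_def bind_assoc_pmf bind_return_pmf)
  also have "\<dots> = bind_pmf (\<mu> n) (\<lambda>b. map_pmf (\<lambda>v. v(n := b))
      (bind_pmf (map_pmf (prefix_sum n) ?V) (\<lambda>a. cond_pmf ?V {v. prefix_sum n v = a})))"
    by (simp flip: disintegrate_pmf)
  also have "\<dots> = bind_pmf (\<mu> n) (\<lambda>b. bind_pmf (map_pmf (prefix_sum n) ?V)
      (\<lambda>a. map_pmf (\<lambda>v. v(n := b)) (cond_pmf ?V {v. prefix_sum n v = a})))"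
    by (simp add: map_bind_pmf)
  also have "\<dots> = bind_pmf (map_pmf (prefix_sum n) ?V) (\<lambda>a. bind_pmf (\<mu> n)
      (\<lambda>b. map_pmf (\<lambda>v. v(n := b)) (cond_pmf ?V {v. prefix_sum n v = a})))"
    by (rule bind_commute_pmf)
  finally show ?thesis
    by (simp add: pair_pmf_def bind_assoc_pmf bind_return_pmf)
qed

lemma prefix_sum_law_Suc:
  "map_pmf (prefix_sum (Suc n)) (vec_law \<mu> (Suc n)) = add_law (map_pmf (prefix_sum n) (vec_law \<mu> n)) (\<mu> n)"
proof -
  let ?V = "vec_law \<mu> n"
  have "vec_law \<mu> (Suc n) = map_pmf (\<lambda>(b, v). v(n := b)) (pair_pmf (\<mu> n) ?V)"
    unfolding vec_law_def lessThan_Suc by (subst Pi_pmf_insert) auto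
  then have "map_pmf (prefix_sum (Suc n)) (vec_law \<mu> (Suc n))
      = map_pmf (\<lambda>(b, v). prefix_sum n v + b) (pair_pmf (\<mu> n) ?V)"
    by (simp add: pmf.map_comp o_def case_prod_unfold)
  also have "\<dots> = map_pmf (\<lambda>(v, b). prefix_sum n v + b) (pair_pmf ?V (\<mu> n))"
    by (subst pair_commute_pmf) (simp add: pmf.map_comp o_def case_prod_unfold)
  also have "\<dots> = add_law (map_pmf (prefix_sum n) ?V) (\<mu> n)"
    by (simp add: add_law_def pair_map_pmf1 pmf.map_comp o_def case_prod_unfold)
  finally show ?thesis .
qed

lemma pf2_prefix_sum_law:
  assumes "\<And>i. pf2 (pmf (\<mu> i))"
  shows "pf2 (pmf (map_pmf (prefix_sum n) (vec_law \<mu> n)))"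
proof (induction n)
  case 0
  have "map_pmf (prefix_sum 0) (vec_law \<mu> 0) = return_pmf 0"
    by (simp add: vec_law_def prefix_sum_def)
  then show ?case
    by (auto simp: pf2_def pmf_return indicator_def)
next
  case (Suc n)
  then show ?case
    unfolding prefix_sum_law_Suc by (intro pf2_add_law assms)
qed

text \<open>
  Efron's theorem: given their sum, independent variables with log-concave laws
  increase with the value of the sum. By \<open>vec_law_Suc\<close>, conditioning on the sum of $n + 1$ entries
  only conditions the pair of the sum of the first \<open>n\<close> entries and the last entry. The former
  has a log-concave law, as a convolution, so \<open>rel_pmf_split_law\<close> couples the pairs
  monotonically; the induction hypothesis then couples the first \<open>n\<close> entries.
\<close>

lemma efron:
  assumes pf2: "\<And>i. pf2 (pmf (\<mu> i))"
  shows "fibrewise_increasing (vec_law \<mu> n) (prefix_sum n)"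
proof (induction n)
  case 0
  show ?case
    by (auto simp: fibrewise_increasing_def vec_law_def prefix_sum_def intro!: rel_pmf_reflI)
next
  case (Suc n)
  let ?V = "vec_law \<mu> n" and ?W = "vec_law \<mu> (Suc n)"
  let ?s = "map_pmf (prefix_sum n) ?V"
  let ?K = "\<lambda>(a, b). map_pmf (\<lambda>v. v(n := b)) (cond_pmf ?V {v. prefix_sum n v = a})"
  have K_supp: "prefix_sum (Suc n) w = a + b" if "a \<in> set_pmf ?s" "w \<in> set_pmf (?K (a, b))" for a b w
  proof -
    have "set_pmf ?V \<inter> {v. prefix_sum n v = a} \<noteq> {}" using that(1) by auto
    then show ?thesis using that(2) by auto
  qed
  have fibre: "cond_pmf ?W {w. prefix_sum (Suc n) w = k} = bind_pmf (split_law ?s (\<mu> n) k) ?K"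
    if "k \<in> set_pmf (add_law ?s (\<mu> n))" for k
    unfolding split_law_def vec_law_Suc using split_law_supp[OF that]
    by (rule cond_bind_pmf) (use K_supp in fastforce)+
  show ?case
    unfolding fibrewise_increasing_def
  proof (intro allI impI)
    fix k k' :: nat
    assume "k \<le> k'" "k \<in> prefix_sum (Suc n) ` set_pmf ?W" "k' \<in> prefix_sum (Suc n) ` set_pmf ?W"
    then have k: "k \<in> set_pmf (add_law ?s (\<mu> n))" and k': "k' \<in> set_pmf (add_law ?s (\<mu> n))"
      unfolding prefix_sum_law_Suc[symmetric] by auto
    have "rel_pmf (\<le>) (bind_pmf (split_law ?s (\<mu> n) k) ?K) (bind_pmf (split_law ?s (\<mu> n) k') ?K)"
    proof (rule rel_pmf_bindI_supp)
      show "rel_pmf (\<lambda>(a, b) (a', b'). a \<le> a' \<and> b \<le> b') (split_law ?s (\<mu> n) k) (split_law ?s (\<mu> n) k')"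
        using \<open>k \<le> k'\<close> k k' by (intro rel_pmf_split_law pf2_prefix_sum_law pf2)
      fix x x' :: "nat \<times> nat"
      assume le: "(\<lambda>(a, b) (a', b'). a \<le> a' \<and> b \<le> b') x x'"
        and "x \<in> set_pmf (split_law ?s (\<mu> n) k)" "x' \<in> set_pmf (split_law ?s (\<mu> n) k')"
      then have supp: "fst x \<in> prefix_sum n ` set_pmf ?V" "fst x' \<in> prefix_sum n ` set_pmf ?V"
        by (auto simp: split_law_def set_cond_pmf[OF split_law_supp[OF k]] set_cond_pmf[OF split_law_supp[OF k']])
      have "rel_pmf (\<le>) (cond_pmf ?V {v. prefix_sum n v = fst x}) (cond_pmf ?V {v. prefix_sum n v = fst x'})"
        using Suc.IH supp le unfolding fibrewise_increasing_def by (auto simp: case_prod_unfold)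
      then have "rel_pmf (\<lambda>v v'. v(n := snd x) \<le> v'(n := snd x'))
          (cond_pmf ?V {v. prefix_sum n v = fst x}) (cond_pmf ?V {v. prefix_sum n v = fst x'})"
        by (rule pmf.rel_mono_strong) (use le in \<open>auto simp: le_fun_def case_prod_unfold\<close>)
      then show "rel_pmf (\<le>) (?K x) (?K x')"
        by (simp add: case_prod_unfold pmf.rel_map)
    qed
    then show "rel_pmf (\<le>) (cond_pmf ?W {w. prefix_sum (Suc n) w = k}) (cond_pmf ?W {w. prefix_sum (Suc n) w = k'})"
      by (simp add: fibre k k')
  qed
qed

section \<open>Reweighting by a function of a statistic\<close>

text \<open>
  If two laws have densities with respect to a common law that depend on a statistic \<open>T\<close> only,
  they share the conditional laws given \<open>T\<close> and differ only in the law of \<open>T\<close>. When the densities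
  are ordered in likelihood ratio, the values of \<open>T\<close> can be coupled monotonically, and
  monotonicity of the conditional laws lifts this coupling to the points themselves.
\<close>

lemma rel_pmf_reweight:
  assumes incr: "fibrewise_increasing p T"
    and p1: "\<And>v. pmf p1 v = w1 (T v) * pmf p v" and p2: "\<And>v. pmf p2 v = w2 (T v) * pmf p v"
    and nonneg: "\<And>k. 0 \<le> w1 k" "\<And>k. 0 \<le> w2 k"
    and lr: "\<And>j k. j < k \<Longrightarrow> w1 k * w2 j \<le> w1 j * w2 k"
  shows "rel_pmf (\<le>) p1 p2"
proof -
  have stat: "pmf (map_pmf T r) k = w k * pmf (map_pmf T p) k"
    if "\<And>v. pmf r v = w (T v) * pmf p v" "\<And>k. 0 \<le> w k" for r w k
  proof -
    have "ennreal (pmf (map_pmf T r) k) = (\<integral>\<^sup>+v. ennreal (pmf r v) * indicator (T -` {k}) v \<partial>count_space UNIV)"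
      by (simp add: ennreal_pmf_map nn_integral_pmf nn_integral_count_space_indicator[symmetric])
    also have "\<dots> = (\<integral>\<^sup>+v. w k * (ennreal (pmf p v) * indicator (T -` {k}) v) \<partial>count_space UNIV)"
      by (intro nn_integral_cong) (auto simp: that ennreal_mult indicator_def)
    also have "\<dots> = w k * (\<integral>\<^sup>+v. ennreal (pmf p v) * indicator (T -` {k}) v \<partial>count_space UNIV)"
      by (rule nn_integral_cmult) auto
    also have "(\<integral>\<^sup>+v. ennreal (pmf p v) * indicator (T -` {k}) v \<partial>count_space UNIV) = pmf (map_pmf T p) k"
      by (simp add: ennreal_pmf_map nn_integral_pmf nn_integral_count_space_indicator[symmetric])
    finally show ?thesis using that(2)[of k] by (simp flip: ennreal_mult)
  qed
  have fibre: "cond_pmf r {v. T v = k} = cond_pmf p {v. T v = k}"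
    and supp: "k \<in> T ` set_pmf p"
    if "\<And>v. pmf r v = w (T v) * pmf p v" "\<And>k. 0 \<le> w k" "k \<in> set_pmf (map_pmf T r)" for r w k
  proof -
    from that(3) obtain v where v: "v \<in> set_pmf r" "T v = k" by auto
    then have "w k * pmf p v \<noteq> 0" by (simp add: set_pmf_iff that(1))
    then have w: "0 < w k" and vp: "v \<in> set_pmf p" using that(2)[of k] by (auto simp: set_pmf_iff less_le)
    then show "k \<in> T ` set_pmf p" using v by auto
    have ne: "set_pmf r \<inter> {v. T v = k} \<noteq> {}" "set_pmf p \<inter> {v. T v = k} \<noteq> {}"
      using v vp by auto
    have "measure_pmf.prob r {v. T v = k} = w k * measure_pmf.prob p {v. T v = k}"
      using stat[of r w k, OF that(1,2)] by (simp add: pmf_map vimage_def)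
    then show "cond_pmf r {v. T v = k} = cond_pmf p {v. T v = k}"
      using w by (intro pmf_eqI) (simp add: pmf_cond ne that(1))
  qed
  have "rel_pmf (\<le>) (bind_pmf (map_pmf T p1) (\<lambda>k. cond_pmf p1 {v. T v = k}))
      (bind_pmf (map_pmf T p2) (\<lambda>k. cond_pmf p2 {v. T v = k}))"
  proof (rule rel_pmf_bindI_supp)
    show "rel_pmf (\<le>) (map_pmf T p1) (map_pmf T p2)"
    proof (rule rel_pmf_le_of_lr)
      fix j k :: nat assume "j < k"
      let ?s = "pmf (map_pmf T p)"
      have "(w1 k * w2 j) * (?s j * ?s k) \<le> (w1 j * w2 k) * (?s j * ?s k)"
        by (intro mult_right_mono lr \<open>j < k\<close>) auto
      then show "pmf (map_pmf T p1) k * pmf (map_pmf T p2) j \<le> pmf (map_pmf T p1) j * pmf (map_pmf T p2) k"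
        by (simp add: stat[OF p1 nonneg(1)] stat[OF p2 nonneg(2)] mult_ac)
    qed
    fix j k assume "j \<le> k" "j \<in> set_pmf (map_pmf T p1)" "k \<in> set_pmf (map_pmf T p2)"
    then show "rel_pmf (\<le>) (cond_pmf p1 {v. T v = j}) (cond_pmf p2 {v. T v = k})"
      using incr supp[OF p1 nonneg(1)] supp[OF p2 nonneg(2)]
      unfolding fibrewise_increasing_def
      by (simp add: fibre[OF p1 nonneg(1)] fibre[OF p2 nonneg(2)])
  qed
  then show ?thesis by (simp flip: disintegrate_pmf)
qed

section \<open>Independent sequences conditioned on their prefix\<close>

definition overwrite :: "nat \<Rightarrow> (nat \<Rightarrow> nat) \<times> (nat \<Rightarrow> nat) \<Rightarrow> nat \<Rightarrow> nat" where
  "overwrite n = (\<lambda>(v, w) i. if i < n then v i else w i)"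

lemma prefix_sum_overwrite [simp]: "prefix_sum n (overwrite n (v, w)) = prefix_sum n v"
  by (simp add: prefix_sum_def overwrite_def)

abbreviation seq_law :: "(nat \<Rightarrow> 'c pmf) \<Rightarrow> (nat \<Rightarrow> 'c) measure" where
  "seq_law \<mu> \<equiv> PiM UNIV (\<lambda>i. measure_pmf (\<mu> i))"

lemma sets_seq_law [measurable_cong]: "sets (seq_law \<mu>) = sets (PiM UNIV (\<lambda>_. count_space UNIV))"
  by (intro sets_PiM_cong) auto

lemma space_seq_law [simp]: "space (seq_law \<mu>) = UNIV"
  by (simp add: space_PiM PiE_def)

lemma prob_space_seq_law: "prob_space (seq_law \<mu>)"
  by (intro prob_space_PiM measure_pmf.prob_space_axioms)

lemma measurable_prefix_sum [measurable]: "prefix_sum n \<in> seq_space \<rightarrow>\<^sub>M count_space UNIV"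
  unfolding prefix_sum_def[abs_def] by measurable

lemma sets_prefix_event: "{w. Q (prefix_sum n w)} \<in> sets seq_space"
  using measurable_sets[OF measurable_prefix_sum, of "Collect Q" n]
  by (simp add: vimage_def space_PiM PiE_def)

lemma measurable_overwrite [measurable]:
  "overwrite n \<in> measure_pmf p \<Otimes>\<^sub>M seq_law \<mu> \<rightarrow>\<^sub>M seq_space"
proof -
  have "(\<lambda>x. overwrite n x i) \<in> measure_pmf p \<Otimes>\<^sub>M seq_law \<mu> \<rightarrow>\<^sub>M count_space UNIV" for i
  proof (cases "i < n")
    case True
    have "(\<lambda>x. (fst x) i) \<in> measure_pmf p \<Otimes>\<^sub>M seq_law \<mu> \<rightarrow>\<^sub>M count_space UNIV"
      by (rule measurable_compose[OF measurable_fst]) simp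
    then show ?thesis using True by (simp add: overwrite_def case_prod_unfold)
  next
    case False
    have "(\<lambda>x. (snd x) i) \<in> measure_pmf p \<Otimes>\<^sub>M seq_law \<mu> \<rightarrow>\<^sub>M count_space UNIV"
      by measurable
    then show ?thesis using False by (simp add: overwrite_def case_prod_unfold)
  qed
  then show ?thesis
    by (intro measurable_PiM_single') (auto simp: space_PiM PiE_def)
qed

text \<open>
  Independence of prefix and tail: replacing the first \<open>n\<close> entries of an independent sequence by
  a fresh copy of the prefix does not change its law. This reduces infinite sequences to a
  discrete prefix and an untouched tail.
\<close>

lemma seq_law_resample_prefix:
  "distr (measure_pmf (vec_law \<mu> n) \<Otimes>\<^sub>M seq_law \<mu>) seq_space (overwrite n) = seq_law \<mu>"
  (is "distr ?P _ _ = _")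
proof (rule measure_eqI_PiM_infinite[symmetric])
  interpret L: prob_space "seq_law \<mu>" by (rule prob_space_seq_law)
  show "finite_measure (seq_law \<mu>)" by unfold_locales
  show "sets (distr ?P seq_space (overwrite n)) = sets (seq_law \<mu>)"
    by (simp add: sets_seq_law)
  fix A :: "nat \<Rightarrow> nat set" and J :: "nat set" assume J: "finite J"
  let ?emb = "\<lambda>J. prod_emb UNIV (\<lambda>i. measure_pmf (\<mu> i)) J (Pi\<^sub>E J A)"
  have emb: "?emb J = {w. \<forall>i\<in>J. w i \<in> A i}" for J
    by (auto simp: prod_emb_def PiE_iff)
  have box: "emeasure (seq_law \<mu>) (?emb J) = (\<Prod>i\<in>J. emeasure (\<mu> i) (A i))" if "finite J" for J
    using that by (intro emeasure_PiM_emb measure_pmf.prob_space_axioms) auto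
  have meas: "?emb J \<in> sets (seq_law \<mu>)" if "finite J" for J
    using that by (intro sets_PiM_I) auto
  let ?B = "\<lambda>i. if i \<in> J then A i else UNIV"
  have head: "emeasure (vec_law \<mu> n) (Pi {..<n} ?B) = (\<Prod>i\<in>J \<inter> {..<n}. emeasure (\<mu> i) (A i))"
  proof -
    have "emeasure (vec_law \<mu> n) (Pi {..<n} ?B) = (\<Prod>i<n. emeasure (\<mu> i) (?B i))"
      by (simp add: measure_pmf.emeasure_eq_measure vec_law_def measure_Pi_pmf_Pi prod_ennreal)
    also have "\<dots> = (\<Prod>i\<in>J \<inter> {..<n}. emeasure (\<mu> i) (A i))"
      by (rule prod.mono_neutral_cong_right) (auto simp: measure_pmf.emeasure_eq_1_AE)
    finally show ?thesis .
  qed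
  have "emeasure (distr ?P seq_space (overwrite n)) (?emb J)
      = emeasure ?P (overwrite n -` ?emb J \<inter> space ?P)"
    using meas[OF J] by (intro emeasure_distr) (auto simp: sets_seq_law)
  also have "overwrite n -` ?emb J \<inter> space ?P = Pi {..<n} ?B \<times> ?emb (J - {..<n})"
    by (auto simp: emb overwrite_def space_pair_measure Pi_iff split: if_splits)
  also have "emeasure ?P \<dots> = (\<Prod>i\<in>J \<inter> {..<n}. emeasure (\<mu> i) (A i)) * (\<Prod>i\<in>J - {..<n}. emeasure (\<mu> i) (A i))"
    using J meas[of "J - {..<n}"] by (subst L.emeasure_pair_measure_Times) (auto simp: head box)
  also have "\<dots> = (\<Prod>i\<in>J. emeasure (\<mu> i) (A i))"
    using J by (subst prod.Int_Diff[of J _ "{..<n}"]) auto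
  finally show "emeasure (seq_law \<mu>) (?emb J) = emeasure (distr ?P seq_space (overwrite n)) (?emb J)"
    by (simp add: box J)
qed simp

lemma distr_indep_with_laws:
  assumes "indep_with_laws M X \<mu>"
  shows "distr M seq_space (\<lambda>\<omega> i. X i \<omega>) = seq_law \<mu>"
    and "(\<lambda>\<omega> i. X i \<omega>) \<in> M \<rightarrow>\<^sub>M seq_space"
proof -
  interpret prob_space M using assms by (simp add: indep_with_laws_def)
  have indep: "indep_vars (\<lambda>_. count_space UNIV) X UNIV"
    and laws: "distr M (count_space UNIV) (X i) = measure_pmf (\<mu> i)" for i
    using assms by (auto simp: indep_with_laws_def)
  then have rv: "X i \<in> M \<rightarrow>\<^sub>M count_space UNIV" for i
    by (auto simp: indep_vars_def)
  then show "(\<lambda>\<omega> i. X i \<omega>) \<in> M \<rightarrow>\<^sub>M seq_space"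
    by (intro measurable_PiM_single') (auto simp: space_PiM PiE_def)
  have "distr M seq_space (\<lambda>\<omega>. \<lambda>i\<in>UNIV. X i \<omega>) = PiM UNIV (\<lambda>i. distr M (count_space UNIV) (X i))"
    using indep indep_vars_iff_distr_eq_PiM[where X = X and I = UNIV, OF _ rv] by simp
  then show "distr M seq_space (\<lambda>\<omega> i. X i \<omega>) = seq_law \<mu>"
    by (simp add: laws restrict_def)
qed

lemma emeasure_seq_law:
  assumes "B \<in> sets seq_space"
  shows "emeasure (seq_law \<mu>) B
    = (\<integral>\<^sup>+v. emeasure (seq_law \<mu>) {w. overwrite n (v, w) \<in> B} \<partial>vec_law \<mu> n)"
proof -
  interpret L: prob_space "seq_law \<mu>" by (rule prob_space_seq_law)
  let ?P = "measure_pmf (vec_law \<mu> n) \<Otimes>\<^sub>M seq_law \<mu>"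
  have "emeasure (seq_law \<mu>) B = emeasure ?P (overwrite n -` B \<inter> space ?P)"
    using assms by (subst seq_law_resample_prefix[of \<mu> n, symmetric]) (intro emeasure_distr measurable_overwrite)
  also have "\<dots> = (\<integral>\<^sup>+v. emeasure (seq_law \<mu>) (Pair v -` (overwrite n -` B \<inter> space ?P)) \<partial>vec_law \<mu> n)"
    using assms by (intro L.emeasure_pair_measure_alt measurable_sets[OF measurable_overwrite])
  finally show ?thesis
    by (simp add: vimage_def space_pair_measure)
qed

lemma sets_partial_sum_event:
  assumes "indep_with_laws M X \<mu>"
  shows "{\<omega> \<in> space M. Q (partial_sum X n \<omega>)} \<in> sets M"
proof -
  have "{\<omega> \<in> space M. Q (partial_sum X n \<omega>)} = (\<lambda>\<omega> i. X i \<omega>) -` {w. Q (prefix_sum n w)} \<inter> space M"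
    by (auto simp: partial_sum_def prefix_sum_def)
  then show ?thesis
    using measurable_sets[OF distr_indep_with_laws(2)[OF assms] sets_prefix_event] by simp
qed

lemma emeasure_prefix_event:
  assumes X: "indep_with_laws M X \<mu>"
  shows "emeasure M {\<omega> \<in> space M. Q (partial_sum X n \<omega>)} = emeasure (vec_law \<mu> n) {v. Q (prefix_sum n v)}"
proof -
  interpret L: prob_space "seq_law \<mu>" by (rule prob_space_seq_law)
  note X' [measurable] = distr_indep_with_laws(2)[OF X]
  let ?E = "{w. Q (prefix_sum n w)}"
  have E: "?E \<in> sets seq_space" by (rule sets_prefix_event)
  have "emeasure M {\<omega> \<in> space M. Q (partial_sum X n \<omega>)} = emeasure (distr M seq_space (\<lambda>\<omega> i. X i \<omega>)) ?E"
    using E by (subst emeasure_distr) (auto simp: partial_sum_def prefix_sum_def intro!: arg_cong[where f = "emeasure M"])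
  also have "\<dots> = (\<integral>\<^sup>+v. emeasure (seq_law \<mu>) {w. overwrite n (v, w) \<in> ?E} \<partial>vec_law \<mu> n)"
    unfolding distr_indep_with_laws(1)[OF X] using E by (rule emeasure_seq_law)
  also have "\<dots> = (\<integral>\<^sup>+v. indicator {v. Q (prefix_sum n v)} v \<partial>vec_law \<mu> n)"
    using L.emeasure_space_1 by (intro nn_integral_cong) (auto simp: indicator_def)
  finally show ?thesis by simp
qed

text \<open>
  The conditioning event depends on the prefix only, so conditioning acts on the fresh prefix in
  \<open>seq_law_resample_prefix\<close> and leaves the tail alone.
\<close>

lemma cond_law_eq:
  assumes X: "indep_with_laws M X \<mu>"
    and ne: "set_pmf (vec_law \<mu> n) \<inter> {v. Q (prefix_sum n v)} \<noteq> {}"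
  shows "cond_law M X (\<lambda>\<omega>. Q (partial_sum X n \<omega>)) =
    distr (measure_pmf (cond_pmf (vec_law \<mu> n) {v. Q (prefix_sum n v)}) \<Otimes>\<^sub>M seq_law \<mu>) seq_space (overwrite n)"
    (is "_ = distr (measure_pmf ?C \<Otimes>\<^sub>M _) _ _")
proof (rule measure_eqI)
  interpret L: prob_space "seq_law \<mu>" by (rule prob_space_seq_law)
  note X' [measurable] = distr_indep_with_laws(2)[OF X]
  let ?E = "{w. Q (prefix_sum n w)}" and ?A = "{\<omega> \<in> space M. Q (partial_sum X n \<omega>)}"
  let ?V = "vec_law \<mu> n"
  have E: "?E \<in> sets seq_space" by (rule sets_prefix_event)
  have A_eq: "?A = (\<lambda>\<omega> i. X i \<omega>) -` ?E \<inter> space M"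
    by (auto simp: partial_sum_def prefix_sum_def)
  have A: "?A \<in> sets M" by (rule sets_partial_sum_event[OF X])
  fix B assume "B \<in> sets (cond_law M X (\<lambda>\<omega>. Q (partial_sum X n \<omega>)))"
  then have B: "B \<in> sets seq_space" by (simp add: cond_law_def)
  have "emeasure (cond_law M X (\<lambda>\<omega>. Q (partial_sum X n \<omega>))) B
      = emeasure M (?A \<inter> ((\<lambda>\<omega> i. X i \<omega>) -` B \<inter> space M)) / emeasure M ?A"
    unfolding cond_law_def using A B measurable_sets[OF X' B] by (subst emeasure_distr) auto
  also have "emeasure M (?A \<inter> ((\<lambda>\<omega> i. X i \<omega>) -` B \<inter> space M)) = emeasure (seq_law \<mu>) (?E \<inter> B)"
    unfolding distr_indep_with_laws(1)[OF X, symmetric] using E B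
    by (subst emeasure_distr) (auto simp: A_eq intro!: arg_cong[where f = "emeasure M"])
  also have "\<dots> = (\<integral>\<^sup>+v. emeasure (seq_law \<mu>) {w. overwrite n (v, w) \<in> ?E \<inter> B} \<partial>?V)"
    using E B by (intro emeasure_seq_law) auto
  also have "\<dots> = (\<integral>\<^sup>+v. emeasure (seq_law \<mu>) {w. overwrite n (v, w) \<in> B} * indicator {v. Q (prefix_sum n v)} v \<partial>?V)"
    by (intro nn_integral_cong) (auto simp: indicator_def)
  also have "\<dots> / emeasure M ?A = (\<integral>\<^sup>+v. emeasure (seq_law \<mu>) {w. overwrite n (v, w) \<in> B} \<partial>?C)"
    unfolding emeasure_prefix_event[OF X] cond_pmf.rep_eq[OF ne]
    by (rule nn_integral_uniform_measure[symmetric]) auto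
  also have "\<dots> = emeasure (measure_pmf ?C \<Otimes>\<^sub>M seq_law \<mu>) (overwrite n -` B \<inter> space (measure_pmf ?C \<Otimes>\<^sub>M seq_law \<mu>))"
    by (subst L.emeasure_pair_measure_alt[OF measurable_sets[OF measurable_overwrite B]])
      (simp add: vimage_def space_pair_measure)
  also have "\<dots> = emeasure (distr (measure_pmf ?C \<Otimes>\<^sub>M seq_law \<mu>) seq_space (overwrite n)) B"
    using B by (intro emeasure_distr[symmetric] measurable_overwrite)
  finally show "emeasure (cond_law M X (\<lambda>\<omega>. Q (partial_sum X n \<omega>))) B
      = emeasure (distr (measure_pmf ?C \<Otimes>\<^sub>M seq_law \<mu>) seq_space (overwrite n)) B" .
qed (simp add: cond_law_def)

lemma measurable_seq_law_map:
  "(\<lambda>w i. f (w i)) \<in> seq_law \<mu> \<rightarrow>\<^sub>M PiM UNIV (\<lambda>_. count_space UNIV)"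
proof (rule measurable_PiM_single')
  fix i
  show "(\<lambda>w. f (w i)) \<in> seq_law \<mu> \<rightarrow>\<^sub>M count_space UNIV"
    by (rule measurable_compose[OF measurable_component_singleton[of i UNIV "\<lambda>i. measure_pmf (\<mu> i)"]]) auto
qed (auto simp: space_PiM PiE_def)

lemma distr_seq_law_map:
  "distr (seq_law \<mu>) (PiM UNIV (\<lambda>_. count_space UNIV)) (\<lambda>w i. f (w i)) = seq_law (\<lambda>i. map_pmf f (\<mu> i))"
proof (rule measure_eqI_PiM_infinite[symmetric])
  let ?N = "PiM UNIV (\<lambda>_. count_space UNIV) :: (nat \<Rightarrow> _) measure"
  interpret L: prob_space "seq_law (\<lambda>i. map_pmf f (\<mu> i))" by (rule prob_space_seq_law)
  show "finite_measure (seq_law (\<lambda>i. map_pmf f (\<mu> i)))" by unfold_locales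
  fix A :: "nat \<Rightarrow> _ set" and J :: "nat set" assume J: "finite J"
  let ?emb = "prod_emb UNIV (\<lambda>i. measure_pmf (map_pmf f (\<mu> i))) J (Pi\<^sub>E J A)"
  have "?emb \<in> sets (seq_law (\<lambda>i. map_pmf f (\<mu> i)))"
    using J by (intro sets_PiM_I) auto
  then have "emeasure (distr (seq_law \<mu>) ?N (\<lambda>w i. f (w i))) ?emb
      = emeasure (seq_law \<mu>) ((\<lambda>w i. f (w i)) -` ?emb \<inter> space (seq_law \<mu>))"
    by (intro emeasure_distr measurable_seq_law_map) (simp add: sets_seq_law)
  also have "(\<lambda>w i. f (w i)) -` ?emb \<inter> space (seq_law \<mu>)
      = prod_emb UNIV (\<lambda>i. measure_pmf (\<mu> i)) J (Pi\<^sub>E J (\<lambda>i. f -` A i))"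
    by (auto simp: prod_emb_def PiE_iff)
  also have "emeasure (seq_law \<mu>) \<dots> = (\<Prod>i\<in>J. emeasure (\<mu> i) (f -` A i))"
    using J by (intro emeasure_PiM_emb measure_pmf.prob_space_axioms) auto
  also have "\<dots> = emeasure (seq_law (\<lambda>i. map_pmf f (\<mu> i))) ?emb"
    using J by (subst emeasure_PiM_emb) (auto intro: measure_pmf.prob_space_axioms)
  finally show "emeasure (seq_law (\<lambda>i. map_pmf f (\<mu> i))) ?emb
      = emeasure (distr (seq_law \<mu>) ?N (\<lambda>w i. f (w i))) ?emb" by simp
qed (auto simp: sets_seq_law)

text \<open>
  Couplings of the prefixes and of every single tail entry, taken independent of each other,
  assemble to a coupling of the sequences.
\<close>

lemma stoch_le_overwrite:
  assumes pq: "rel_pmf (\<le>) p q" and tail: "\<And>i. rel_pmf (\<le>) (\<mu> i) (\<mu>' i)"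
  shows "distr (measure_pmf p \<Otimes>\<^sub>M seq_law \<mu>) seq_space (overwrite n)
    \<prec>\<^sub>s\<^sub>t distr (measure_pmf q \<Otimes>\<^sub>M seq_law \<mu>') seq_space (overwrite n)"
proof -
  from pq obtain c where c: "\<And>x y. (x, y) \<in> set_pmf c \<Longrightarrow> x \<le> y" "map_pmf fst c = p" "map_pmf snd c = q"
    by (auto elim!: rel_pmf.cases)
  have "\<exists>d. (\<forall>x y. (x, y) \<in> set_pmf d \<longrightarrow> x \<le> y) \<and> map_pmf fst d = \<mu> i \<and> map_pmf snd d = \<mu>' i" for i
    using tail[of i] by (auto elim!: rel_pmf.cases)
  then obtain d where d: "\<And>i x y. (x, y) \<in> set_pmf (d i) \<Longrightarrow> x \<le> y"
      "\<And>i. map_pmf fst (d i) = \<mu> i" "\<And>i. map_pmf snd (d i) = \<mu>' i"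
    by metis
  interpret L: prob_space "seq_law d" by (rule prob_space_seq_law)
  let ?P = "measure_pmf c \<Otimes>\<^sub>M seq_law d"
  interpret P: pair_prob_space "measure_pmf c" "seq_law d" ..
  \<comment> \<open>One map serves for both marginals: \<open>g\<close> and \<open>h\<close> are both \<open>fst\<close> or both \<open>snd\<close>.\<close>
  define proj :: "((nat \<times> nat) \<Rightarrow> nat) \<Rightarrow> (((nat \<Rightarrow> nat) \<times> (nat \<Rightarrow> nat)) \<Rightarrow> nat \<Rightarrow> nat)
      \<Rightarrow> ((nat \<Rightarrow> nat) \<times> (nat \<Rightarrow> nat)) \<times> (nat \<Rightarrow> nat \<times> nat) \<Rightarrow> nat \<Rightarrow> nat"
    where "proj g h = (\<lambda>(x, w). overwrite n (h x, \<lambda>i. g (w i)))" for g h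
  have proj: "distr ?P seq_space (proj g h)
      = distr (measure_pmf (map_pmf h c) \<Otimes>\<^sub>M seq_law (\<lambda>i. map_pmf g (d i))) seq_space (overwrite n)"
    and meas: "proj g h \<in> ?P \<rightarrow>\<^sub>M seq_space" for g h
  proof -
    have g: "(\<lambda>w i. g (w i)) \<in> seq_law d \<rightarrow>\<^sub>M seq_space"
      by (rule measurable_seq_law_map)
    have map: "(\<lambda>(x, w). (h x, \<lambda>i. g (w i))) \<in> ?P \<rightarrow>\<^sub>M count_space UNIV \<Otimes>\<^sub>M seq_space"
      unfolding case_prod_unfold
      by (intro measurable_Pair measurable_compose[OF measurable_fst] measurable_compose[OF measurable_snd g]) auto
    interpret T: prob_space "seq_law (\<lambda>i. map_pmf g (d i))" by (rule prob_space_seq_law)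
    have ov: "overwrite n \<in> count_space UNIV \<Otimes>\<^sub>M seq_space \<rightarrow>\<^sub>M seq_space"
      using measurable_overwrite[of n p \<mu>]
      by (subst measurable_cong_sets[where M' = "measure_pmf p \<Otimes>\<^sub>M seq_law \<mu>" and N' = seq_space])
        (auto intro!: sets_pair_measure_cong simp: sets_seq_law)
    have comp: "proj g h = overwrite n \<circ> (\<lambda>(x, w). (h x, \<lambda>i. g (w i)))"
      by (auto simp: proj_def)
    show "proj g h \<in> ?P \<rightarrow>\<^sub>M seq_space"
      unfolding comp using map ov by (rule measurable_comp)
    have "distr ?P seq_space (proj g h)
        = distr (distr ?P (count_space UNIV \<Otimes>\<^sub>M seq_space) (\<lambda>(x, w). (h x, \<lambda>i. g (w i)))) seq_space (overwrite n)"
      unfolding comp using map ov by (rule distr_distr[symmetric, rotated])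
    also have "distr ?P (count_space UNIV \<Otimes>\<^sub>M seq_space) (\<lambda>(x, w). (h x, \<lambda>i. g (w i)))
        = distr (measure_pmf c) (count_space UNIV) h \<Otimes>\<^sub>M distr (seq_law d) seq_space (\<lambda>w i. g (w i))"
      by (rule pair_measure_distr[symmetric])
        (auto simp: g distr_seq_law_map intro: T.sigma_finite_measure_axioms)
    finally show "distr ?P seq_space (proj g h)
        = distr (measure_pmf (map_pmf h c) \<Otimes>\<^sub>M seq_law (\<lambda>i. map_pmf g (d i))) seq_space (overwrite n)"
      by (simp add: distr_seq_law_map map_pmf_rep_eq)
  qed
  define F where "F z = (proj fst fst z, proj snd snd z)" for z
  have F: "F \<in> ?P \<rightarrow>\<^sub>M seq_space \<Otimes>\<^sub>M seq_space"
    unfolding F_def by (intro measurable_Pair meas)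
  have "AE z in ?P. proj fst fst z \<le> proj snd snd z"
  proof -
    have "AE w in seq_law d. w i \<in> set_pmf (d i)" for i
      by (rule AE_PiM_component) (auto intro: measure_pmf.prob_space_axioms simp: AE_measure_pmf_iff)
    then have tail_supp: "AE w in seq_law d. \<forall>i. w i \<in> set_pmf (d i)"
      by (simp add: AE_all_countable)
    have "AE z in ?P. fst z \<in> set_pmf c \<and> (\<forall>i. snd z i \<in> set_pmf (d i))"
    proof (rule P.AE_pair_measure)
      have [measurable]: "(\<lambda>z. fst z \<in> set_pmf c) \<in> ?P \<rightarrow>\<^sub>M count_space UNIV"
        by (rule measurable_compose[OF measurable_fst]) simp
      have [measurable]: "(\<lambda>z. snd z i \<in> set_pmf (d i)) \<in> ?P \<rightarrow>\<^sub>M count_space UNIV" for i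
        by (rule measurable_compose[OF measurable_snd], rule measurable_compose[OF measurable_component_singleton]) auto
      show "{z \<in> space ?P. fst z \<in> set_pmf c \<and> (\<forall>i. snd z i \<in> set_pmf (d i))} \<in> sets ?P"
        by measurable
      show "AE x in measure_pmf c. AE w in seq_law d. fst (x, w) \<in> set_pmf c \<and> (\<forall>i. snd (x, w) i \<in> set_pmf (d i))"
        using tail_supp by (simp add: AE_measure_pmf_iff)
    qed
    then show ?thesis
    proof eventually_elim
      case (elim z)
      then have "fst (fst z) \<le> snd (fst z)" "\<And>i. fst (snd z i) \<le> snd (snd z i)"
        using c(1) d(1) by (metis prod.collapse)+
      then show ?case by (auto simp: proj_def overwrite_def case_prod_unfold le_fun_def)
    qed
  qed
  moreover have "{z \<in> space (seq_space \<Otimes>\<^sub>M seq_space). fst z \<le> snd z} \<in> sets (seq_space \<Otimes>\<^sub>M seq_space)"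
  proof -
    have "(\<lambda>z. fst z i \<le> snd z i) \<in> seq_space \<Otimes>\<^sub>M seq_space \<rightarrow>\<^sub>M count_space UNIV" for i :: nat
    proof -
      have "(\<lambda>z. (fst z i, snd z i)) \<in> seq_space \<Otimes>\<^sub>M seq_space \<rightarrow>\<^sub>M count_space UNIV \<Otimes>\<^sub>M count_space (UNIV :: nat set)"
        by measurable
      then have "(\<lambda>z. (fst z i, snd z i)) \<in> seq_space \<Otimes>\<^sub>M seq_space \<rightarrow>\<^sub>M count_space (UNIV :: (nat \<times> nat) set)"
        by (simp add: pair_measure_countable)
      from measurable_compose[OF this, of "\<lambda>(a, b). a \<le> b" "count_space UNIV"] show ?thesis
        by simp
    qed
    then show ?thesis
      unfolding le_fun_def by measurable
  qed
  ultimately have le: "AE z in distr ?P (seq_space \<Otimes>\<^sub>M seq_space) F. fst z \<le> snd z"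
    by (subst AE_distr_iff[OF F]) (auto simp: F_def)
  show ?thesis
    unfolding stoch_le_def
  proof (intro exI conjI)
    show "prob_space (distr ?P (seq_space \<Otimes>\<^sub>M seq_space) F)"
      using F by (rule P.prob_space_distr)
    show "distr (distr ?P (seq_space \<Otimes>\<^sub>M seq_space) F) seq_space fst
        = distr (measure_pmf p \<Otimes>\<^sub>M seq_law \<mu>) seq_space (overwrite n)"
      using proj[of fst fst] by (subst distr_distr[OF _ F]) (auto simp: F_def[abs_def] o_def c d)
    show "distr (distr ?P (seq_space \<Otimes>\<^sub>M seq_space) F) seq_space snd
        = distr (measure_pmf q \<Otimes>\<^sub>M seq_law \<mu>') seq_space (overwrite n)"
      using proj[of snd snd] by (subst distr_distr[OF _ F]) (auto simp: F_def[abs_def] o_def c d)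
  qed (use le in simp_all)
qed

section \<open>Tilting\<close>

lemma partition_fun_finite:
  assumes "0 < l" "ereal l < lambda_max \<nu>"
  shows "partition_fun l (\<nu> i) < \<infinity>"
proof -
  obtain l'' where l'': "l < l''" "\<And>i. partition_fun l'' (\<nu> i) < \<infinity>"
    using assms(2) unfolding lambda_max_def less_Sup_iff by auto
  have "partition_fun l (\<nu> i) \<le> partition_fun l'' (\<nu> i)"
    unfolding partition_fun_def
    using assms(1) l''(1) by (intro suminf_le ennreal_leI mult_right_mono power_mono) auto
  then show ?thesis
    using l''(2)[of i] by (rule order_le_less_trans)
qed

lemma pmf_tilt_weight:
  assumes "0 < l" "partition_fun l p < \<infinity>"
  obtains c where "0 < c" "\<And>x. pmf (tilt l p) x = c * l ^ x * pmf p x"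
proof
  have "enn2real (partition_fun l p) \<noteq> 0"
  proof
    assume "enn2real (partition_fun l p) = 0"
    then have "pmf (tilt l p) x = 0" for x
      by (simp add: pmf_tilt[OF assms])
    then show False
      using set_pmf_not_empty[of "tilt l p"] by (auto simp: set_pmf_iff)
  qed
  then show "0 < 1 / enn2real (partition_fun l p)"
    by (simp add: less_le)
qed (simp add: pmf_tilt[OF assms])

text \<open>
  Tilting all entries by the same parameter reweights the vector by a function of the sum of its
  entries; this is why tilting does not affect the conditional laws given the sum.
\<close>

lemma pmf_vec_law_tilt:
  assumes "0 < l" "\<And>i. partition_fun l (\<nu> i) < \<infinity>"
  obtains c where "0 < c"
    "\<And>v. pmf (vec_law (\<lambda>i. tilt l (\<nu> i)) n) v = c * l ^ prefix_sum n v * pmf (vec_law \<nu> n) v"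
proof -
  have "\<exists>c>0. \<forall>x. pmf (tilt l (\<nu> i)) x = c * l ^ x * pmf (\<nu> i) x" for i
    using pmf_tilt_weight[OF assms(1) assms(2)[of i]] by metis
  then obtain c where c: "\<And>i. 0 < c i" "\<And>i x. pmf (tilt l (\<nu> i)) x = c i * l ^ x * pmf (\<nu> i) x"
    by metis
  show ?thesis
  proof
    show "0 < (\<Prod>i<n. c i)" using c(1) by (intro prod_pos) auto
    show "pmf (vec_law (\<lambda>i. tilt l (\<nu> i)) n) v = (\<Prod>i<n. c i) * l ^ prefix_sum n v * pmf (vec_law \<nu> n) v" for v
      by (auto simp: vec_law_def pmf_Pi c(2) prod.distrib prefix_sum_def power_sum)
  qed
qed

lemma power_lr:
  fixes l l' :: real
  assumes "0 < l" "l \<le> l'" "j < k"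
  shows "l ^ k * l' ^ j \<le> l ^ j * l' ^ k"
proof -
  have "(l ^ j * l' ^ j) * l ^ (k - j) \<le> (l ^ j * l' ^ j) * l' ^ (k - j)"
    using assms by (intro mult_left_mono power_mono) auto
  moreover have "l ^ k = l ^ j * l ^ (k - j)" "l' ^ k = l' ^ j * l' ^ (k - j)"
    using assms by (simp_all flip: power_add)
  ultimately show ?thesis by (simp add: mult_ac)
qed

lemma rel_pmf_tilt:
  assumes "0 < l" "l \<le> l'" "partition_fun l p < \<infinity>" "partition_fun l' p < \<infinity>"
  shows "rel_pmf (\<le>) (tilt l p) (tilt l' p)"
proof (rule rel_pmf_le_of_lr)
  fix x y :: nat assume "x < y"
  have "0 < l'" using assms by simp
  obtain c where c: "0 < c" "\<And>x. pmf (tilt l p) x = c * l ^ x * pmf p x"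
    using pmf_tilt_weight[OF assms(1,3)] by metis
  obtain c' where c': "0 < c'" "\<And>x. pmf (tilt l' p) x = c' * l' ^ x * pmf p x"
    using pmf_tilt_weight[OF \<open>0 < l'\<close> assms(4)] by metis
  have "(c * c' * pmf p x * pmf p y) * (l ^ y * l' ^ x) \<le> (c * c' * pmf p x * pmf p y) * (l ^ x * l' ^ y)"
    using c(1) c'(1) by (intro mult_left_mono power_lr assms \<open>x < y\<close>) auto
  then show "pmf (tilt l p) y * pmf (tilt l' p) x \<le> pmf (tilt l p) x * pmf (tilt l' p) y"
    by (simp add: c(2) c'(2) mult_ac)
qed

lemma set_pmf_vec_law_tilt:
  assumes "0 < l" "\<And>i. partition_fun l (\<nu> i) < \<infinity>"
  shows "set_pmf (vec_law (\<lambda>i. tilt l (\<nu> i)) n) = set_pmf (vec_law \<nu> n)"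
proof -
  obtain c where "0 < c"
    "\<And>v. pmf (vec_law (\<lambda>i. tilt l (\<nu> i)) n) v = c * l ^ prefix_sum n v * pmf (vec_law \<nu> n) v"
    using pmf_vec_law_tilt[of l \<nu> n] assms by metis
  then show ?thesis
    using assms(1) by (auto simp: set_pmf_iff)
qed

text \<open>
  All five comparisons of the theorem are instances of this one. The conditioned vector has the
  density $b\,\lambda^k 1_Q(k)$ at total $k$ with respect to the untilted vector. For
  $\lambda \<le> \lambda'$ the powers are ordered in likelihood ratio, and the
  hypothesis on \<open>Q\<close> and \<open>Q'\<close> says that the indicators are ordered likewise. It holds when \<open>Q\<close> and \<open>Q'\<close>
  are the same half-line, and vacuously when no point of \<open>Q'\<close> lies below a point of \<open>Q\<close>.
\<close>

lemma cond_law_tilt_mono: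
  assumes lc: "\<And>i. log_concave (\<nu> i)"
    and X: "indep_with_laws M X (\<lambda>i. tilt l (\<nu> i))" and X': "indep_with_laws M' X' (\<lambda>i. tilt l' (\<nu> i))"
    and l: "0 < l" "l \<le> l'" "ereal l' < lambda_max \<nu>"
    and Q: "Q k" "k \<in> prefix_sum n ` set_pmf (vec_law \<nu> n)"
    and Q': "Q' k'" "k' \<in> prefix_sum n ` set_pmf (vec_law \<nu> n)"
    and lr: "\<And>i j. i < j \<Longrightarrow> Q j \<Longrightarrow> Q' i \<Longrightarrow> Q i \<and> Q' j"
  shows "cond_law M X (\<lambda>\<omega>. Q (partial_sum X n \<omega>)) \<prec>\<^sub>s\<^sub>t cond_law M' X' (\<lambda>\<omega>. Q' (partial_sum X' n \<omega>))"
proof -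
  have "0 < l'" "ereal l < lambda_max \<nu>"
    using l by (auto intro: order_le_less_trans[of "ereal l" "ereal l'"])
  then have fin: "partition_fun l (\<nu> i) < \<infinity>" "partition_fun l' (\<nu> i) < \<infinity>" for i
    using l by (auto intro!: partition_fun_finite simp del: infinity_ennreal_def)
  let ?V = "vec_law (\<lambda>i. tilt l (\<nu> i)) n" and ?V' = "vec_law (\<lambda>i. tilt l' (\<nu> i)) n"
  let ?E = "{v. Q (prefix_sum n v)}" and ?E' = "{v. Q' (prefix_sum n v)}"
  have ne: "set_pmf ?V \<inter> ?E \<noteq> {}" and ne': "set_pmf ?V' \<inter> ?E' \<noteq> {}"
    using Q Q' set_pmf_vec_law_tilt[OF l(1) fin(1)] set_pmf_vec_law_tilt[OF \<open>0 < l'\<close> fin(2)] by auto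
  obtain c where c: "0 < c" "\<And>v. pmf ?V v = c * l ^ prefix_sum n v * pmf (vec_law \<nu> n) v"
    using pmf_vec_law_tilt[of l \<nu> n] l(1) fin(1) by metis
  obtain c' where c': "0 < c'" "\<And>v. pmf ?V' v = c' * l' ^ prefix_sum n v * pmf (vec_law \<nu> n) v"
    using pmf_vec_law_tilt[of l' \<nu> n] \<open>0 < l'\<close> fin(2) by metis
  define b where "b = c / measure_pmf.prob ?V ?E"
  define b' where "b' = c' / measure_pmf.prob ?V' ?E'"
  have b: "0 \<le> b" "0 \<le> b'" using c c' by (auto simp: b_def b'_def)
  have "rel_pmf (\<le>) (cond_pmf ?V ?E) (cond_pmf ?V' ?E')"
  proof (rule rel_pmf_reweight)
    show "fibrewise_increasing (vec_law \<nu> n) (prefix_sum n)"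
      using lc by (intro efron log_concave_imp_pf2)
    let ?w = "\<lambda>k. if Q k then b * l ^ k else 0" and ?w' = "\<lambda>k. if Q' k then b' * l' ^ k else 0"
    show "pmf (cond_pmf ?V ?E) v = ?w (prefix_sum n v) * pmf (vec_law \<nu> n) v" for v
      by (simp add: pmf_cond[OF ne] c(2) b_def)
    show "pmf (cond_pmf ?V' ?E') v = ?w' (prefix_sum n v) * pmf (vec_law \<nu> n) v" for v
      by (simp add: pmf_cond[OF ne'] c'(2) b'_def)
    show "0 \<le> ?w k" "0 \<le> ?w' k" for k
      using b l \<open>0 < l'\<close> by auto
    fix i j :: nat assume "i < j"
    have "(b * b') * (l ^ j * l' ^ i) \<le> (b * b') * (l ^ i * l' ^ j)"
      using b by (intro mult_left_mono power_lr l \<open>i < j\<close>) auto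
    then show "?w j * ?w' i \<le> ?w i * ?w' j"
      using lr[OF \<open>i < j\<close>] b l \<open>0 < l'\<close> by (auto simp: mult_ac)
  qed
  then show ?thesis
    unfolding cond_law_eq[OF X ne] cond_law_eq[OF X' ne']
    using l fin by (intro stoch_le_overwrite rel_pmf_tilt)
qed

text \<open>
  A sum that never exceeds \<open>R\<close> has mean at most \<open>R\<close>, for each parameter; and all tilted laws have
  the same support.
\<close>

lemma prefix_sum_exceeds_below_mean:
  assumes X: "\<And>l. 0 < l \<Longrightarrow> ereal l < lambda_max \<nu> \<Longrightarrow> indep_with_laws (M l) (X l) (\<lambda>i. tilt l (\<nu> i))"
    and R: "0 < R" "ennreal R < (SUP l\<in>{l. 0 < l \<and> ereal l < lambda_max \<nu>}.
              \<integral>\<^sup>+ \<omega>. of_nat (partial_sum (X l) n \<omega>) \<partial>M l)"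
  obtains k where "R < real k" "k \<in> prefix_sum n ` set_pmf (vec_law \<nu> n)"
proof -
  obtain l where l: "0 < l" "ereal l < lambda_max \<nu>"
    and mean: "ennreal R < (\<integral>\<^sup>+ \<omega>. of_nat (partial_sum (X l) n \<omega>) \<partial>M l)"
    using R(2) unfolding less_SUP_iff by auto
  note Xl = X[OF l]
  interpret prob_space "M l" using Xl by (simp add: indep_with_laws_def)
  let ?V = "vec_law (\<lambda>i. tilt l (\<nu> i)) n"
  have "\<exists>v\<in>set_pmf ?V. R < real (prefix_sum n v)"
  proof (rule ccontr)
    assume "\<not> ?thesis"
    then have "{v. R < real (prefix_sum n v)} \<inter> set_pmf ?V = {}" by auto
    then have "emeasure ?V {v. R < real (prefix_sum n v)} = 0"
      using emeasure_Int_set_pmf[of ?V "{v. R < real (prefix_sum n v)}"] by simp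
    then have "emeasure (M l) {\<omega> \<in> space (M l). R < real (partial_sum (X l) n \<omega>)} = 0"
      using emeasure_prefix_event[OF Xl, where Q = "\<lambda>k. R < real k"] by simp
    then have "AE \<omega> in M l. \<not> R < real (partial_sum (X l) n \<omega>)"
      using sets_partial_sum_event[OF Xl, where Q = "\<lambda>k. R < real k"] by (intro AE_I) auto
    then have "(\<integral>\<^sup>+ \<omega>. of_nat (partial_sum (X l) n \<omega>) \<partial>M l) \<le> (\<integral>\<^sup>+ \<omega>. ennreal R \<partial>M l)"
      by (intro nn_integral_mono_AE) (auto simp: not_less ennreal_of_nat_eq_real_of_nat intro!: ennreal_leI)
    also have "\<dots> = ennreal R" by (simp add: emeasure_space_1)
    finally show False using mean by simp
  qed
  then show ?thesis
    using that by (auto simp: set_pmf_vec_law_tilt[OF l(1) partition_fun_finite[OF l]])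
qed

lemma zero_in_prefix_sums:
  assumes "\<And>i. log_concave (\<nu> i)"
  shows "0 \<in> prefix_sum n ` set_pmf (vec_law \<nu> n)"
proof (rule image_eqI)
  have "pmf (\<nu> i) 0 > 0" for i
    using assms[of i] by (simp add: log_concave_def enat_0)
  then show "(\<lambda>_. 0) \<in> set_pmf (vec_law \<nu> n)"
    by (auto simp: vec_law_def set_pmf_iff pmf_Pi less_le)
qed (simp add: prefix_sum_def)

section \<open>Stochastic monotonicity of the conditioned sequences\<close>

theorem proposition2:
  fixes \<nu> :: "nat \<Rightarrow> nat pmf"
    and M :: "'a measure" and X :: "nat \<Rightarrow> 'a \<Rightarrow> nat"
    and Mt :: "real \<Rightarrow> 'b measure" and Xt :: "real \<Rightarrow> nat \<Rightarrow> 'b \<Rightarrow> nat"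
    and n :: nat
  assumes "\<And>i. log_concave (\<nu> i)"
    and "indep_with_laws M X \<nu>"
    and "\<And>l. 0 < l \<Longrightarrow> ereal l < lambda_max \<nu> \<Longrightarrow>
           indep_with_laws (Mt l) (Xt l) (\<lambda>i. tilt l (\<nu> i))"
    and "n \<ge> 1"
  shows "(\<forall>R::real. 0 < R \<longrightarrow>
            ennreal R < (SUP l\<in>{l. 0 < l \<and> ereal l < lambda_max \<nu>}.
              \<integral>\<^sup>+ \<omega>. of_nat (partial_sum (Xt l) n \<omega>) \<partial>Mt l) \<longrightarrow>
            (\<forall>l l'. 0 < l \<longrightarrow> l < l' \<longrightarrow> ereal l' < lambda_max \<nu> \<longrightarrow>
              cond_law (Mt l) (Xt l) (\<lambda>\<omega>. real (partial_sum (Xt l) n \<omega>) > R)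
                \<prec>\<^sub>s\<^sub>t cond_law (Mt l') (Xt l') (\<lambda>\<omega>. real (partial_sum (Xt l') n \<omega>) > R) \<and>
              cond_law (Mt l) (Xt l) (\<lambda>\<omega>. real (partial_sum (Xt l) n \<omega>) < R)
                \<prec>\<^sub>s\<^sub>t cond_law (Mt l') (Xt l') (\<lambda>\<omega>. real (partial_sum (Xt l') n \<omega>) < R) \<and>
              cond_law (Mt l) (Xt l) (\<lambda>\<omega>. real (partial_sum (Xt l) n \<omega>) < R)
                \<prec>\<^sub>s\<^sub>t cond_law (Mt l') (Xt l') (\<lambda>\<omega>. real (partial_sum (Xt l') n \<omega>) > R))) \<and>
         (\<forall>(l::real) (k::nat). 0 < l \<longrightarrow> ereal l < lambda_max \<nu> \<longrightarrow>
            measure M {\<omega> \<in> space M. partial_sum X n \<omega> = k} > 0 \<longrightarrow>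
            cond_law (Mt l) (Xt l) (\<lambda>\<omega>. partial_sum (Xt l) n \<omega> \<le> k)
              \<prec>\<^sub>s\<^sub>t cond_law (Mt l) (Xt l) (\<lambda>\<omega>. partial_sum (Xt l) n \<omega> = k) \<and>
            cond_law (Mt l) (Xt l) (\<lambda>\<omega>. partial_sum (Xt l) n \<omega> = k)
              \<prec>\<^sub>s\<^sub>t cond_law (Mt l) (Xt l) (\<lambda>\<omega>. partial_sum (Xt l) n \<omega> \<ge> k))"
proof (intro conjI allI impI)
  \<comment> \<open>The witnesses \<open>k\<close> and \<open>0\<close> show that the conditioning events have positive probability.\<close>
  note mono = cond_law_tilt_mono[where \<nu> = \<nu> and n = n, OF assms(1) assms(3) assms(3)]
  note zero = zero_in_prefix_sums[of \<nu> n, OF assms(1)]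
  {
    fix R l l' :: real
    assume R: "0 < R" "ennreal R < (SUP l\<in>{l. 0 < l \<and> ereal l < lambda_max \<nu>}.
              \<integral>\<^sup>+ \<omega>. of_nat (partial_sum (Xt l) n \<omega>) \<partial>Mt l)"
      and l: "0 < l" "l < l'" "ereal l' < lambda_max \<nu>"
    obtain k where k: "R < real k" "k \<in> prefix_sum n ` set_pmf (vec_law \<nu> n)"
      using prefix_sum_exceeds_below_mean[OF assms(3) R] by blast
    have l': "0 < l'" "ereal l < lambda_max \<nu>" "l \<le> l'"
      using l by (auto intro: order_less_trans[of "ereal l" "ereal l'"])
    show "cond_law (Mt l) (Xt l) (\<lambda>\<omega>. real (partial_sum (Xt l) n \<omega>) > R)
        \<prec>\<^sub>s\<^sub>t cond_law (Mt l') (Xt l') (\<lambda>\<omega>. real (partial_sum (Xt l') n \<omega>) > R)"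
      by (rule mono[where Q = "\<lambda>s. real s > R" and Q' = "\<lambda>s. real s > R", OF _ _ _ _ _ _ _ k k])
        (use l l' in auto)
    show "cond_law (Mt l) (Xt l) (\<lambda>\<omega>. real (partial_sum (Xt l) n \<omega>) < R)
        \<prec>\<^sub>s\<^sub>t cond_law (Mt l') (Xt l') (\<lambda>\<omega>. real (partial_sum (Xt l') n \<omega>) < R)"
      by (rule mono[where Q = "\<lambda>s. real s < R" and Q' = "\<lambda>s. real s < R", OF _ _ _ _ _ _ _ _ zero _ zero])
        (use l l' R in auto)
    show "cond_law (Mt l) (Xt l) (\<lambda>\<omega>. real (partial_sum (Xt l) n \<omega>) < R)
        \<prec>\<^sub>s\<^sub>t cond_law (Mt l') (Xt l') (\<lambda>\<omega>. real (partial_sum (Xt l') n \<omega>) > R)"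
      by (rule mono[where Q = "\<lambda>s. real s < R" and Q' = "\<lambda>s. real s > R", OF _ _ _ _ _ _ _ _ zero k])
        (use l l' R in auto)
  }
  fix l :: real and k :: nat
  assume l: "0 < l" "ereal l < lambda_max \<nu>" and pos: "measure M {\<omega> \<in> space M. partial_sum X n \<omega> = k} > 0"
  have "measure_pmf.prob (vec_law \<nu> n) {v. prefix_sum n v = k} > 0"
    using pos emeasure_prefix_event[OF assms(2), where Q = "\<lambda>s. s = k"] by (simp add: measure_def)
  then have "set_pmf (vec_law \<nu> n) \<inter> {v. prefix_sum n v = k} \<noteq> {}"
    by (auto simp: measure_pmf_zero_iff zero_less_measure_iff)
  then have k: "k \<in> prefix_sum n ` set_pmf (vec_law \<nu> n)"
    by auto
  show "cond_law (Mt l) (Xt l) (\<lambda>\<omega>. partial_sum (Xt l) n \<omega> \<le> k)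
      \<prec>\<^sub>s\<^sub>t cond_law (Mt l) (Xt l) (\<lambda>\<omega>. partial_sum (Xt l) n \<omega> = k)"
    by (rule mono[where Q = "\<lambda>s. s \<le> k" and Q' = "\<lambda>s. s = k", OF _ _ _ _ _ _ _ _ k _ k]) (use l in auto)
  show "cond_law (Mt l) (Xt l) (\<lambda>\<omega>. partial_sum (Xt l) n \<omega> = k)
      \<prec>\<^sub>s\<^sub>t cond_law (Mt l) (Xt l) (\<lambda>\<omega>. partial_sum (Xt l) n \<omega> \<ge> k)"
    by (rule mono[where Q = "\<lambda>s. s = k" and Q' = "\<lambda>s. s \<ge> k", OF _ _ _ _ _ _ _ _ k _ k]) (use l in auto)
qed

end
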